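(* Let $(\bar x,\bar\lambda)\in\mathbb{R}^n\times\mathbb{R}^{m+1}$ be a solution to the KKT system $$\nabla f(x)+\nabla\Phi(x)^*\lambda=0,\qquad \lambda\in N_{\mathcal Q}(\Phi(x)),$$ let the second-order sufficient condition (SOSC, see context) hold at $(\bar x,\bar\lambda)$, let the multiplier mapping $M_{\bar x}$ be calm at $((0,0),\bar\lambda)$, and let $\Lambda(\bar x)=\{\bar\lambda\}$. Then there exist positive numbers $\bar\gamma$ and $\bar\rho$ ensuring the following: for any starting point $(x^0,\lambda^0)\in\mathbb{B}_{\bar\gamma}(\bar x,\bar\lambda)$, any penalty parameters $\rho_k\ge\bar\rho$ ($k=0,1,\dots$), and any tolerance rule $\varepsilon_k=o(\sigma(x^k,\lambda^k))$ (see context), the augmented Lagrangian method generates a sequence of iterates $(x^k,\lambda^k)$, i.e. there exists a sequence starting at $(x^0,\lambda^0)$ with $$\|\nabla_x\mathscr{L}(x^{k+1},\lambda^k,\rho_k)\|\le\varepsilon_k,\qquad\lambda^{k+1}=\Pi_{-\mathcal Q}\big(\rho_k\Phi(x^{k+1})+\lambda^k\big),\qquad k=0,1,2,\dots,$$ such that $(x^k,\lambda^k)$ converges to $(\bar x,\bar\lambda)$ as $k\to\infty$, and the rate of this convergence is linear.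
   Context: Setting: the second-order cone program "minimize $f(x)$ subject to $\Phi(x)\in\mathcal Q$", where $f:\mathbb{R}^n\to\mathbb{R}$ and $\Phi:\mathbb{R}^n\to\mathbb{R}^{m+1}$ are twice continuously differentiable around the reference point $\bar x$, and $\mathcal Q:=\{y=(y_0,y_r)\in\mathbb{R}\times\mathbb{R}^m\mid\|y_r\|\le y_0\}$. $\mathbb{B}$ is the closed unit ball of the space in question, $\mathbb{B}_\gamma(z)$ the closed ball of radius $\gamma$ centered at $z$; $A^*$ is the transpose of $A$; $\Pi_\Omega$ is the projection onto $\Omega$. The Lagrangian is $L(x,\lambda):=f(x)+\langle\lambda,\Phi(x)\rangle$, and the augmented Lagrangian is $$\mathscr{L}(x,\lambda,\rho):=f(x)+\tfrac{\rho}{2}\mathrm{dist}^2\big(\Phi(x)+\rho^{-1}\lambda;\mathcal Q\big)-\tfrac12\rho^{-1}\|\lambda\|^2,\quad(x,\lambda,\rho)\in\mathbb{R}^n\times\mathbb{R}^{m+1}\times(0,\infty).$$ $T_{\mathcal Q}$, $N_{\mathcal Q}$ are the tangent cone and the convex-analysis normal cone to $\mathcal Q$ (with $N_{\mathcal Q}(y)=\emptyset$ for $y\notin\mathcal Q$); for $y\in\mathcal Q$, $v\in N_{\mathcal Q}(y)$ the critical cone is $K_{\mathcal Q}(y,v):=T_{\mathcal Q}(y)\cap\{v\}^\perp$. $\delta_{\mathcal Q}$ is the indicator function of $\mathcal Q$. The set of Lagrange multipliers is $\Lambda(\bar x):=\{\lambda\in\mathbb{R}^{m+1}\mid\nabla_xL(\bar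 x,\lambda)=0,\ \lambda\in N_{\mathcal Q}(\Phi(\bar x))\}$. For $\varphi:\mathbb{R}^p\to(-\infty,\infty]$ with $\varphi(\bar z)$ finite and $\bar v\in\mathbb{R}^p$, the second subderivative is $\mathrm{d}^2\varphi(\bar z,\bar v)(w):=\liminf_{t\downarrow0,\,w'\to w}\big[\varphi(\bar z+tw')-\varphi(\bar z)-t\langle\bar v,w'\rangle\big]/(\tfrac12t^2)$. SOSC at $(\bar x,\bar\lambda)$: $\langle\nabla^2_{xx}L(\bar x,\bar\lambda)w,w\rangle+\mathrm{d}^2\delta_{\mathcal Q}(\Phi(\bar x),\bar\lambda)(\nabla\Phi(\bar x)w)>0$ for all $w\in\mathbb{R}^n\setminus\{0\}$ with $\nabla\Phi(\bar x)w\in K_{\mathcal Q}(\Phi(\bar x),\bar\lambda)$. The multiplier mapping $M_{\bar x}:\mathbb{R}^n\times\mathbb{R}^{m+1}\rightrightarrows\mathbb{R}^{m+1}$ is $M_{\bar x}(v,w):=\{\lambda\mid\nabla_xL(\bar x,\lambda)=v,\ \lambda\in N_{\mathcal Q}(\Phi(\bar x)+w)\}$. A set-valued mapping $F$ is calm at $(\bar p,\bar q)\in\mathrm{gph}\,F$ if there exist $\ell\ge0$ and neighborhoods $U$ of $\bar p$, $V$ of $\bar q$ with $F(p)\cap V\subset F(\bar p)+\ell\|p-\bar p\|\mathbb{B}$ for all $p\in U$. Residual: $\sigma(x,\lambda):=\|\nabla_xL(x,\lambda)\|+\|\Phi(x)-\Pi_{\mathcal Q}(\Phi(x)+\lambda)\|$.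 The tolerance rule $\varepsilon_k=o(\sigma(x^k,\lambda^k))$ means $\varepsilon_k=\omega(\sigma(x^k,\lambda^k))$ for an arbitrary function $\omega:[0,\infty)\to[0,\infty)$ with $\omega(0)=0$ and $\omega(t)/t\to0$ as $t\downarrow0$ (the choice $\omega\equiv0$ is the exact method). Augmented Lagrangian method: given $(x^k,\lambda^k)$, $\rho_k\ge\bar\rho$ and $\varepsilon_k\ge0$, find $x^{k+1}$ with $\|\nabla_x\mathscr{L}(x^{k+1},\lambda^k,\rho_k)\|\le\varepsilon_k$, and set $\lambda^{k+1}:=\Pi_{-\mathcal Q}(\rho_k\Phi(x^{k+1})+\lambda^k)$ (the termination test is ignored here). Linear rate of convergence means: there is $q\in(0,1)$ with $\|x^{k+1}-\bar x\|+\|\lambda^{k+1}-\bar\lambda\|\le q\big(\|x^k-\bar x\|+\|\lambda^k-\bar\lambda\|\big)$ for all sufficiently large $k$. *)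

theory Defs
  imports "HOL-Analysis.Analysis"
begin

section \<open>Differentiability\<close>

definition C2_around :: "('a::real_normed_vector \<Rightarrow> 'b::real_normed_vector) \<Rightarrow> 'a \<Rightarrow> bool" where
  "C2_around F a \<longleftrightarrow>
     (\<exists>U (F' :: 'a \<Rightarrow> 'a \<Rightarrow>\<^sub>L 'b) (F'' :: 'a \<Rightarrow> 'a \<Rightarrow>\<^sub>L ('a \<Rightarrow>\<^sub>L 'b)).
        open U \<and> a \<in> U \<and>
        (\<forall>x\<in>U. (F has_derivative blinfun_apply (F' x)) (at x)) \<and>
        (\<forall>x\<in>U. (F' has_derivative blinfun_apply (F'' x)) (at x)) \<and>
        continuous_on U F'')"

text \<open>Unspecified where \<open>F\<close> is not differentiable.\<close>
definition grad :: "('a::real_inner \<Rightarrow> real) \<Rightarrow> 'a \<Rightarrow> 'a" where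
  "grad F x = (THE g. GDERIV F x :> g)"

definition hess :: "('a::real_inner \<Rightarrow> real) \<Rightarrow> 'a \<Rightarrow> 'a \<Rightarrow> 'a" where
  "hess F x = frechet_derivative (grad F) (at x)"

section \<open>Variational analysis\<close>

definition tangent_cone :: "'a::real_normed_vector set \<Rightarrow> 'a \<Rightarrow> 'a set" where
  "tangent_cone S y =
     {w. \<exists>(t :: nat \<Rightarrow> real) u. (\<forall>k. t k > 0) \<and> t \<longlonglongrightarrow> 0 \<and> u \<longlonglongrightarrow> w \<and>
           (\<forall>k. y + t k *\<^sub>R u k \<in> S)}"

definition normal_cone :: "'a::real_inner set \<Rightarrow> 'a \<Rightarrow> 'a set" where
  "normal_cone S y = (if y \<in> S then {v. \<forall>z\<in>S. v \<bullet> (z - y) \<le> 0} else {})"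

definition critical_cone :: "'a::real_inner set \<Rightarrow> 'a \<Rightarrow> 'a \<Rightarrow> 'a set" where
  "critical_cone S y v = tangent_cone S y \<inter> {w. v \<bullet> w = 0}"

definition delta :: "'a set \<Rightarrow> 'a \<Rightarrow> ereal" where
  "delta S y = (if y \<in> S then 0 else \<infinity>)"

text \<open>The lower limit over \<open>w' \<rightarrow> w\<close> includes \<open>w' = w\<close>, hence \<open>nhds w\<close> rather than \<open>at w\<close>.\<close>
definition second_subderivative ::
    "('a::real_inner \<Rightarrow> ereal) \<Rightarrow> 'a \<Rightarrow> 'a \<Rightarrow> 'a \<Rightarrow> ereal" where
  "second_subderivative \<phi> z v w =
     Liminf (at_right (0::real) \<times>\<^sub>F nhds w)
       (\<lambda>(t, w'). (\<phi> (z + t *\<^sub>R w') - \<phi> z - ereal (t * (v \<bullet> w'))) / ereal (t\<^sup>2 / 2))"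

definition calm_at ::
    "('a::real_normed_vector \<Rightarrow> 'b::real_normed_vector set) \<Rightarrow> 'a \<Rightarrow> 'b \<Rightarrow> bool" where
  "calm_at F p q \<longleftrightarrow> q \<in> F p \<and>
     (\<exists>l\<ge>0. \<exists>U V. open U \<and> p \<in> U \<and> open V \<and> q \<in> V \<and>
        (\<forall>p'\<in>U. F p' \<inter> V \<subseteq>
           {y + (l * norm (p' - p)) *\<^sub>R b | y b. y \<in> F p \<and> b \<in> cball 0 1}))"

section \<open>The second-order cone program\<close>

definition soc :: "(real \<times> (real^'m)) set" where
  "soc = {y. norm (snd y) \<le> fst y}"

definition lagrangian ::
    "('a \<Rightarrow> real) \<Rightarrow> ('a \<Rightarrow> 'b::real_inner) \<Rightarrow> 'a \<Rightarrow> 'b \<Rightarrow> real" where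
  "lagrangian f \<Phi> x \<mu> = f x + \<mu> \<bullet> \<Phi> x"

definition aug_lagrangian ::
    "('a \<Rightarrow> real) \<Rightarrow> ('a \<Rightarrow> real \<times> (real^'m)) \<Rightarrow> 'a \<Rightarrow> real \<times> (real^'m) \<Rightarrow> real \<Rightarrow> real" where
  "aug_lagrangian f \<Phi> x \<mu> \<rho> =
     f x + \<rho> / 2 * (infdist (\<Phi> x + inverse \<rho> *\<^sub>R \<mu>) soc)\<^sup>2 - 1 / 2 * inverse \<rho> * (norm \<mu>)\<^sup>2"

definition KKT ::
    "(real^'n \<Rightarrow> real) \<Rightarrow> (real^'n \<Rightarrow> real \<times> (real^'m)) \<Rightarrow> real^'n \<Rightarrow> real \<times> (real^'m) \<Rightarrow> bool" where
  "KKT f \<Phi> x \<mu> \<longleftrightarrow>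
     grad f x + adjoint (frechet_derivative \<Phi> (at x)) \<mu> = 0 \<and> \<mu> \<in> normal_cone soc (\<Phi> x)"

definition multipliers ::
    "(real^'n \<Rightarrow> real) \<Rightarrow> (real^'n \<Rightarrow> real \<times> (real^'m)) \<Rightarrow> real^'n \<Rightarrow> (real \<times> (real^'m)) set" where
  "multipliers f \<Phi> x =
     {\<mu>. grad (\<lambda>x'. lagrangian f \<Phi> x' \<mu>) x = 0 \<and> \<mu> \<in> normal_cone soc (\<Phi> x)}"

definition multiplier_map ::
    "(real^'n \<Rightarrow> real) \<Rightarrow> (real^'n \<Rightarrow> real \<times> (real^'m)) \<Rightarrow> real^'n \<Rightarrow>
     (real^'n) \<times> (real \<times> (real^'m)) \<Rightarrow> (real \<times> (real^'m)) set" where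
  "multiplier_map f \<Phi> x = (\<lambda>(v, w).
     {\<mu>. grad (\<lambda>x'. lagrangian f \<Phi> x' \<mu>) x = v \<and> \<mu> \<in> normal_cone soc (\<Phi> x + w)})"

definition SOSC ::
    "(real^'n \<Rightarrow> real) \<Rightarrow> (real^'n \<Rightarrow> real \<times> (real^'m)) \<Rightarrow> real^'n \<Rightarrow> real \<times> (real^'m) \<Rightarrow> bool" where
  "SOSC f \<Phi> x \<mu> \<longleftrightarrow>
     (\<forall>w. w \<noteq> 0 \<longrightarrow> frechet_derivative \<Phi> (at x) w \<in> critical_cone soc (\<Phi> x) \<mu> \<longrightarrow>
        ereal (hess (\<lambda>x'. lagrangian f \<Phi> x' \<mu>) x w \<bullet> w)
          + second_subderivative (delta soc) (\<Phi> x) \<mu> (frechet_derivative \<Phi> (at x) w) > 0)"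

section \<open>The augmented Lagrangian method\<close>

definition residual ::
    "(real^'n \<Rightarrow> real) \<Rightarrow> (real^'n \<Rightarrow> real \<times> (real^'m)) \<Rightarrow> real^'n \<Rightarrow> real \<times> (real^'m) \<Rightarrow> real" where
  "residual f \<Phi> x \<mu> =
     norm (grad (\<lambda>x'. lagrangian f \<Phi> x' \<mu>) x) + norm (\<Phi> x - closest_point soc (\<Phi> x + \<mu>))"

definition tolerance_rule :: "(real \<Rightarrow> real) \<Rightarrow> bool" where
  "tolerance_rule \<omega> \<longleftrightarrow>
     (\<forall>t\<ge>0. \<omega> t \<ge> 0) \<and> \<omega> 0 = 0 \<and> ((\<lambda>t. \<omega> t / t) \<longlongrightarrow> 0) (at_right 0)"

text \<open>
  As \<open>f\<close> and \<open>\<Phi>\<close> are only smooth near the reference point, the two differentiability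
  requirements make sure that the gradients in the residual at the current iterate and in the
  stopping rule for the next one exist.
\<close>
definition ALM_sequence ::
    "(real^'n \<Rightarrow> real) \<Rightarrow> (real^'n \<Rightarrow> real \<times> (real^'m)) \<Rightarrow> (nat \<Rightarrow> real) \<Rightarrow> (real \<Rightarrow> real) \<Rightarrow>
     (nat \<Rightarrow> real^'n) \<Rightarrow> (nat \<Rightarrow> real \<times> (real^'m)) \<Rightarrow> bool" where
  "ALM_sequence f \<Phi> \<rho> \<omega> x \<mu> \<longleftrightarrow> (\<forall>k.
     (\<lambda>x'. lagrangian f \<Phi> x' (\<mu> k)) differentiable at (x k) \<and>
     (\<lambda>x'. aug_lagrangian f \<Phi> x' (\<mu> k) (\<rho> k)) differentiable at (x (Suc k)) \<and>
     norm (grad (\<lambda>x'. aug_lagrangian f \<Phi> x' (\<mu> k) (\<rho> k)) (x (Suc k)))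
       \<le> \<omega> (residual f \<Phi> (x k) (\<mu> k)) \<and>
     \<mu> (Suc k) = closest_point (uminus ` soc) (\<rho> k *\<^sub>R \<Phi> (x (Suc k)) + \<mu> k))"

definition linear_rate ::
    "(nat \<Rightarrow> 'a::real_normed_vector) \<Rightarrow> (nat \<Rightarrow> 'b::real_normed_vector) \<Rightarrow> 'a \<Rightarrow> 'b \<Rightarrow> bool" where
  "linear_rate x \<mu> xb \<mu>b \<longleftrightarrow>
     (\<exists>q. 0 < q \<and> q < 1 \<and>
        (\<forall>\<^sub>F k in sequentially.
           norm (x (Suc k) - xb) + norm (\<mu> (Suc k) - \<mu>b)
             \<le> q * (norm (x k - xb) + norm (\<mu> k - \<mu>b))))"

end

theory Submission
  imports Defs
begin

text \<open>
  The exact method already does: one takes for \<open>x\<^sup>k\<^sup>+\<^sup>1\<close> a minimiser of the augmented Lagrangian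
  over a small ball. SOSC gives quadratic growth of the augmented Lagrangian at \<open>\<mu>b\<close> for a large
  penalty, hence, with an error quadratic in the multiplier, for all nearby multipliers and larger
  penalties; so the minimiser is interior and stationary. With \<open>y\<close> the projection of
  \<open>\<Phi> x + \<mu> / \<rho>\<close> onto the cone, the updated multiplier \<open>\<mu>'\<close> is normal to the cone at \<open>y\<close>,
  makes the Lagrangian stationary at \<open>x\<close>, and satisfies \<open>\<rho> (y - \<Phi> x) = \<mu> - \<mu>'\<close>. SOSC and
  calmness of the multiplier map yield the error bound
  \<open>\<bar>x - xb\<bar> + \<bar>\<mu>' - \<mu>b\<bar> \<le> \<kappa> \<bar>y - \<Phi> x\<bar>\<close> for such triples: the derivative of the normal cone graph
  is controlled by the second subderivative of the indicator. For \<open>\<rho> \<ge> 3 \<kappa>\<close> this is a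
  contraction with factor \<open>1/2\<close>.
\<close>

section \<open>The second-order cone\<close>

lemma zero_in_soc: "0 \<in> soc"
  by (simp add: soc_def)

lemma soc_nonempty: "soc \<noteq> {}"
  using zero_in_soc by blast

lemma closed_soc: "closed soc"
  unfolding soc_def by (intro closed_Collect_le continuous_intros)

lemma soc_add: "y \<in> soc \<Longrightarrow> z \<in> soc \<Longrightarrow> y + z \<in> soc"
  unfolding soc_def using norm_triangle_ineq[of "snd y" "snd z"] by auto

lemma soc_scaleR: "0 \<le> t \<Longrightarrow> y \<in> soc \<Longrightarrow> t *\<^sub>R y \<in> soc"
  by (simp add: soc_def mult_left_mono)

lemma convex_soc: "convex soc"
  unfolding convex_def by (simp add: soc_add soc_scaleR)

text \<open>Half of the self-duality of the cone: Cauchy-Schwarz bounds the inner product of the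
  tails by the product of the heads.\<close>

lemma soc_inner_nonneg:
  assumes "y \<in> soc" "z \<in> soc"
  shows "0 \<le> y \<bullet> z"
proof -
  have "norm (snd y) * norm (snd z) \<le> fst y * fst z"
    using assms by (intro mult_mono) (auto simp: soc_def intro: order_trans[OF norm_ge_zero])
  moreover have "- (norm (snd y) * norm (snd z)) \<le> snd y \<bullet> snd z"
    using Cauchy_Schwarz_ineq2[of "snd y" "snd z"] by linarith
  ultimately show ?thesis
    by (simp add: inner_prod_def)
qed

text \<open>For a self-dual cone, normality is complementarity, an algebraic condition symmetric in
  \<open>y\<close> and \<open>- v\<close>.\<close>

lemma normal_cone_soc_iff:
  "v \<in> normal_cone soc y \<longleftrightarrow> y \<in> soc \<and> - v \<in> soc \<and> v \<bullet> y = 0"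
proof
  assume v: "v \<in> normal_cone soc y"
  then have y: "y \<in> soc" and le: "\<And>z. z \<in> soc \<Longrightarrow> v \<bullet> (z - y) \<le> 0"
    by (auto simp: normal_cone_def split: if_splits)
  \<comment> \<open>Multiples of \<open>y\<close> stay in the cone, so testing with
    \<open>2 *\<^sub>R y\<close> and with \<open>0\<close> gives both inequalities for
    \<open>v \<bullet> y\<close>.\<close>
  have "v \<bullet> y \<le> 0" using le[OF soc_scaleR[of 2, OF _ y]] by (simp add: scaleR_2 algebra_simps)
  moreover have "0 \<le> v \<bullet> y" using le[OF zero_in_soc] by simp
  ultimately have vy: "v \<bullet> y = 0" by simp
  have "norm (snd v) \<le> - fst v"
  proof (cases "snd v = 0")
    case True
    have "v \<bullet> ((1, 0) - y) \<le> 0" by (intro le) (simp add: soc_def)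
    then have "v \<bullet> (1, 0) \<le> 0" using vy by (simp only: inner_diff_right)
    then show ?thesis using True by (simp add: inner_prod_def)
  next
    case False
    \<comment> \<open>The boundary ray aligned with the tail of \<open>v\<close> gives the sharp
      bound on \<open>fst v\<close>.\<close>
    have "v \<bullet> ((norm (snd v), snd v) - y) \<le> 0" by (intro le) (simp add: soc_def)
    then have "norm (snd v) * (fst v + norm (snd v)) \<le> 0"
      using vy by (simp add: inner_diff_right inner_prod_def algebra_simps dot_square_norm power2_eq_square)
    then show ?thesis using False by (simp add: mult_le_0_iff)
  qed
  then show "y \<in> soc \<and> - v \<in> soc \<and> v \<bullet> y = 0"
    using y vy by (simp add: soc_def)
next
  assume *: "y \<in> soc \<and> - v \<in> soc \<and> v \<bullet> y = 0"
  then have "v \<bullet> (z - y) \<le> 0" if "z \<in> soc" for z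
    using soc_inner_nonneg[of "- v" z] that by (simp add: inner_diff_right)
  then show "v \<in> normal_cone soc y" using * by (simp add: normal_cone_def)
qed

section \<open>Projection onto the cone and the squared distance to it\<close>

abbreviation soc_proj :: "real \<times> (real^'m) \<Rightarrow> real \<times> (real^'m)" where
  "soc_proj \<equiv> closest_point soc"

lemma soc_proj_in: "soc_proj z \<in> soc"
  by (rule closest_point_in_set[OF closed_soc soc_nonempty])

lemma soc_proj_normal: "z - soc_proj z \<in> normal_cone soc (soc_proj z)"
  unfolding normal_cone_def
  using closest_point_dot[OF convex_soc closed_soc, of _ z] soc_proj_in[of z] by simp

text \<open>In the expanded squared distance the cross term has the right sign for normal vectors.
  Together with \<open>soc_proj_normal\<close> this characterises the projection.\<close>

lemma soc_proj_eqI: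
  assumes "v \<in> normal_cone soc y"
  shows "soc_proj (y + v) = y"
proof (rule sym, rule closest_point_unique[OF convex_soc closed_soc])
  show "y \<in> soc" using assms by (simp add: normal_cone_soc_iff)
  show "\<forall>z\<in>soc. dist (y + v) y \<le> dist (y + v) z"
  proof
    fix z :: "real \<times> (real^'a)" assume "z \<in> soc"
    then have "v \<bullet> (z - y) \<le> 0" using assms by (auto simp: normal_cone_def split: if_splits)
    moreover have "(norm (v - (z - y)))\<^sup>2 = (norm v)\<^sup>2 - 2 * (v \<bullet> (z - y)) + (norm (z - y))\<^sup>2"
      by (simp add: power2_norm_eq_inner inner_diff_left inner_diff_right inner_commute)
    ultimately have "(norm v)\<^sup>2 \<le> (norm (v - (z - y)))\<^sup>2"
      using zero_le_power2[of "norm (z - y)"] by linarith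
    then have "norm v \<le> norm (v - (z - y))" by (rule power2_le_imp_le) simp
    then show "dist (y + v) y \<le> dist (y + v) z" by (simp add: dist_norm algebra_simps)
  qed
qed

lemma normal_cone_soc_scaleR: "0 \<le> t \<Longrightarrow> v \<in> normal_cone soc y \<Longrightarrow> t *\<^sub>R v \<in> normal_cone soc y"
  using soc_scaleR[of t "- v"] by (simp add: normal_cone_soc_iff)

text \<open>Moreau's decomposition: the polar cone is the negative of \<open>soc\<close>, so
  projecting onto it leaves the residual of the projection onto \<open>soc\<close>. The multiplier
  update is thus \<open>\<rho>\<close> times such a residual, hence normal to the cone.\<close>

lemma closest_point_uminus_soc:
  assumes "0 \<le> \<rho>"
  shows "closest_point (uminus ` soc) (\<rho> *\<^sub>R z) = \<rho> *\<^sub>R (z - soc_proj z)"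
proof (rule sym, rule closest_point_unique)
  show "convex (uminus ` soc)" by (rule convex_negations[OF convex_soc])
  show "closed (uminus ` soc)" by (rule closed_negations[OF closed_soc])
  let ?w = "\<rho> *\<^sub>R (z - soc_proj z)"
  have n: "?w \<in> normal_cone soc (soc_proj z)"
    by (intro normal_cone_soc_scaleR assms soc_proj_normal)
  then have w: "- ?w \<in> soc" "?w \<bullet> soc_proj z = 0" by (auto simp: normal_cone_soc_iff)
  then show "?w \<in> uminus ` soc" by (metis imageI minus_minus)
  show "\<forall>v\<in>uminus ` soc. dist (\<rho> *\<^sub>R z) ?w \<le> dist (\<rho> *\<^sub>R z) v"
  proof (intro ballI, elim imageE)
    fix v s :: "real \<times> (real^'a)" assume v: "v = - s" and "s \<in> soc"
    then have "0 \<le> \<rho> * (soc_proj z \<bullet> s)"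
      using assms soc_inner_nonneg[OF soc_proj_in, of s z] by simp
    moreover have "(norm (\<rho> *\<^sub>R soc_proj z + (?w + s)))\<^sup>2 = (norm (\<rho> *\<^sub>R soc_proj z))\<^sup>2
        + 2 * \<rho> * (?w \<bullet> soc_proj z) + 2 * (\<rho> * (soc_proj z \<bullet> s)) + (norm (?w + s))\<^sup>2"
      by (simp only: power2_norm_eq_inner inner_simps) (simp add: inner_commute algebra_simps)
    ultimately have "(norm (\<rho> *\<^sub>R soc_proj z))\<^sup>2 \<le> (norm (\<rho> *\<^sub>R soc_proj z + (?w + s)))\<^sup>2"
      using arg_cong[OF w(2), of "\<lambda>a. 2 * \<rho> * a"] zero_le_power2[of "norm (?w + s)"] by linarith
    then have "norm (\<rho> *\<^sub>R soc_proj z) \<le> norm (\<rho> *\<^sub>R soc_proj z + (?w + s))"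
      by (rule power2_le_imp_le) simp
    then show "dist (\<rho> *\<^sub>R z) ?w \<le> dist (\<rho> *\<^sub>R z) v" unfolding v
      by (simp add: dist_norm algebra_simps)
  qed
qed

lemma infdist_soc: "infdist z soc = norm (z - soc_proj z)"
  using setdist_closest_point[OF closed_soc soc_nonempty, of z]
  by (simp add: infdist_eq_setdist dist_norm)

text \<open>The projection of one point is a competitor for the distance of another, which gives the
  quadratic upper estimate \<open>up\<close>. Using it from both ends, with nonexpansiveness of the
  projection, makes the estimate two-sided.\<close>

lemma GDERIV_infdist_soc_squared: "GDERIV (\<lambda>z. (infdist z soc)\<^sup>2) z :> 2 *\<^sub>R (z - soc_proj z)"
  unfolding gderiv_def
proof (rule has_derivativeI_sandwich[of 1 _ _ _ _ "\<lambda>y. 5 * norm (y - z)"])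
  show "bounded_linear (\<lambda>h. h \<bullet> 2 *\<^sub>R (z - soc_proj z))" by (rule bounded_linear_inner_left)
  show "((\<lambda>y. 5 * norm (y - z)) \<longlongrightarrow> 0) (at z)"
    by (auto intro!: tendsto_eq_intros)
  fix y :: "real \<times> (real^'a)" assume "y \<in> UNIV" "y \<noteq> z"
  define h where "h = y - z"
  let ?d = "\<lambda>z. (infdist z soc)\<^sup>2"
  have up: "?d (a + h) \<le> ?d a + 2 * ((a - soc_proj a) \<bullet> h) + (norm h)\<^sup>2" for a h :: "real \<times> (real^'a)"
  proof -
    have "infdist (a + h) soc \<le> norm (a - soc_proj a + h)"
      using infdist_le[OF soc_proj_in, of "a + h" a] by (simp add: dist_norm algebra_simps)
    then have "?d (a + h) \<le> (norm (a - soc_proj a + h))\<^sup>2"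
      by (intro power_mono infdist_nonneg)
    then show ?thesis
      by (simp add: infdist_soc[of a] power2_norm_eq_inner inner_add_left inner_add_right inner_commute)
  qed
  have "?d z \<le> ?d y - 2 * ((y - soc_proj y) \<bullet> h) + (norm h)\<^sup>2"
  proof -
    have "y + - h = z" by (simp add: h_def)
    then show ?thesis using up[of y "- h"] by (simp only: inner_minus_right norm_minus_cancel)
  qed
  moreover have "((z - soc_proj z) - (y - soc_proj y)) \<bullet> h \<le> 2 * (norm h)\<^sup>2"
  proof -
    have "norm (soc_proj y - soc_proj z) \<le> norm h"
      using closest_point_lipschitz[OF convex_soc closed_soc soc_nonempty, of y z]
      by (simp add: dist_norm h_def)
    moreover have e: "(z - soc_proj z) - (y - soc_proj y) = (soc_proj y - soc_proj z) - h"
      by (simp add: h_def)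
    ultimately have "norm ((z - soc_proj z) - (y - soc_proj y)) \<le> 2 * norm h"
      unfolding e using norm_triangle_ineq4[of "soc_proj y - soc_proj z" h] by linarith
    then show ?thesis
      using norm_cauchy_schwarz[of "(z - soc_proj z) - (y - soc_proj y)" h]
        mult_right_mono[of _ "2 * norm h" "norm h"] by (fastforce simp: power2_eq_square)
  qed
  moreover have "?d y \<le> ?d z + 2 * ((z - soc_proj z) \<bullet> h) + (norm h)\<^sup>2"
    using up[of z h] by (simp add: h_def)
  \<comment> \<open>The constant 5 is the 1 of \<open>up\<close> plus twice the 2 of the comparison
    of residuals.\<close>
  ultimately have "\<bar>?d y - ?d z - 2 * ((z - soc_proj z) \<bullet> h)\<bar> \<le> 5 * (norm h)\<^sup>2"
    unfolding inner_diff_left[of "z - soc_proj z"] using zero_le_power2[of "norm h"] by linarith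
  then have "norm (?d y - ?d z - h \<bullet> 2 *\<^sub>R (z - soc_proj z)) \<le> 5 * norm h * norm h"
    by (simp add: power2_eq_square inner_commute)
  then show "norm (?d y - ?d z - (y - z) \<bullet> 2 *\<^sub>R (z - soc_proj z)) / norm (y - z) \<le> 5 * norm (y - z)"
    using \<open>y \<noteq> z\<close> by (simp add: h_def[symmetric] divide_le_eq)
qed auto

section \<open>Second subderivatives\<close>

lemma Liminf_le_of_sequence:
  fixes F :: "'a filter" and h :: "'a \<Rightarrow> ereal"
  assumes "filterlim s F sequentially" "\<And>k. h (s k) \<le> b k" "b \<longlonglongrightarrow> c"
  shows "Liminf F h \<le> c"
proof -
  have "Liminf F h \<le> Liminf (filtermap s sequentially) h"
    using assms(1) unfolding filterlim_def Liminf_def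
    by (intro SUP_subset_mono) (auto simp: le_filter_def)
  also have "\<dots> \<le> Liminf sequentially (\<lambda>k. h (s k))"
    by (rule Liminf_filtermap_le)
  also have "\<dots> \<le> Liminf sequentially b"
    by (intro Liminf_mono always_eventually allI assms(2))
  also have "\<dots> = c" by (rule lim_imp_Liminf[OF _ assms(3)]) simp
  finally show ?thesis .
qed

text \<open>A lower limit is bounded by the values along any one sequence, and at feasible points
  only the linear term of the quotient survives. The majorant \<open>b\<close> serves cases where
  just an upper estimate of that term is known to converge.\<close>

lemma second_subderivative_delta_le:
  assumes t: "\<And>k. 0 < t k" "t \<longlonglongrightarrow> 0" and u: "u \<longlonglongrightarrow> w"
    and S: "z \<in> S" "\<And>k. z + t k *\<^sub>R u k \<in> S"
    and b: "\<And>k. - 2 * (v \<bullet> u k) / t k \<le> b k" "b \<longlonglongrightarrow> c"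
  shows "second_subderivative (delta S) z v w \<le> ereal c"
  unfolding second_subderivative_def
proof (rule Liminf_le_of_sequence)
  show "filterlim (\<lambda>k. (t k, u k)) (at_right 0 \<times>\<^sub>F nhds w) sequentially"
    using t u by (intro filterlim_Pair) (auto simp: filterlim_at intro!: always_eventually less_imp_neq[THEN not_sym])
  show "(case (t k, u k) of (t, w') \<Rightarrow>
      (delta S (z + t *\<^sub>R w') - delta S z - ereal (t * (v \<bullet> w'))) / ereal (t\<^sup>2 / 2))
      \<le> ereal (b k)" for k
  proof -
    have "- (t k * (v \<bullet> u k)) / ((t k)\<^sup>2 / 2) = - 2 * (v \<bullet> u k) / t k"
      using t(1)[of k] by (simp add: power2_eq_square)
    then show ?thesis using S b(1)[of k] t(1)[of k] by (simp add: delta_def)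
  qed
  show "(\<lambda>k. ereal (b k)) \<longlonglongrightarrow> ereal c" using b(2) by simp
qed

text \<open>Complementarity forces equality in Cauchy-Schwarz, so both vectors lie on the boundary
  of their cones with parallel tails. The factor is a quotient of norms because the reflection is
  isometric.\<close>

lemma normal_cone_soc_nonzero:
  assumes "v \<in> normal_cone soc y" "v \<noteq> 0" "y \<noteq> 0"
  shows "v = - (norm v / norm y) *\<^sub>R (fst y, - snd y)"
proof -
  define a b p q where "a = - fst v" and "b = snd v" and "p = fst y" and "q = snd y"
  have v: "v = (- a, b)" and y: "y = (p, q)" by (simp_all add: a_def b_def p_def q_def)
  have b: "norm b \<le> a" and q: "norm q \<le> p" and eq: "b \<bullet> q = a * p"
    using assms(1) unfolding normal_cone_soc_iff by (auto simp: soc_def v y inner_prod_def)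
  have "a \<noteq> 0" using b assms(2) v by (auto simp: zero_prod_def)
  then have a: "0 < a" using b norm_ge_zero[of b] by linarith
  have "p \<noteq> 0" using q assms(3) y by (auto simp: zero_prod_def)
  then have p: "0 < p" using q norm_ge_zero[of q] by linarith
  have cs: "a * p \<le> norm b * norm q" using norm_cauchy_schwarz[of b q] eq by simp
  have "norm q = p"
  proof (rule ccontr)
    assume "norm q \<noteq> p"
    then have "a * norm q < a * p" using a q by simp
    moreover have "norm b * norm q \<le> a * norm q" by (intro mult_right_mono b) simp
    ultimately show False using cs by linarith
  qed
  moreover have "norm b = a"
    using cs b p \<open>norm q = p\<close> by (simp add: mult_le_cancel_right_pos antisym)
  ultimately have "a *\<^sub>R q = p *\<^sub>R b"
    using eq norm_cauchy_schwarz_eq[of b q] by simp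
  moreover have "b = (1 / p) *\<^sub>R (p *\<^sub>R b)" using p by simp
  ultimately have "b = (a / p) *\<^sub>R q" by (metis scaleR_scaleR times_divide_eq_left mult_1)
  then have veq: "v = - (a / p) *\<^sub>R (p, - q)" using p by (simp add: v)
  have "norm v = (a / p) * norm (p, - q)" unfolding veq norm_scaleR using a p by simp
  then have "norm v = (a / p) * norm y" by (simp add: y norm_Pair)
  then have "norm v / norm y = a / p" using assms(3) by simp
  then show ?thesis using veq by (simp add: p_def q_def)
qed

text \<open>If \<open>yb\<close> and \<open>\<mu>b\<close> are both nonzero, nearby pairs of the graph consist of boundary points and
  negative multiples of their reflections; comparing the factors shows that \<open>- \<mu>b \<bullet> U k\<close> and
  \<open>- E k \<bullet> yb\<close>, whose sum is \<open>t k * (E k \<bullet> U k)\<close>, are asymptotically equal.\<close>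
lemma normal_cone_soc_graph_limit:
  fixes yb \<mu>b u \<eta> :: "real \<times> (real^'m)"
  assumes t: "\<And>k. 0 < t k" "t \<longlonglongrightarrow> 0" and U: "U \<longlonglongrightarrow> u" and E: "E \<longlonglongrightarrow> \<eta>"
    and base: "\<mu>b \<in> normal_cone soc yb"
    and graph: "\<And>k. \<mu>b + t k *\<^sub>R E k \<in> normal_cone soc (yb + t k *\<^sub>R U k)"
  shows "\<mu>b \<bullet> u = 0" "second_subderivative (delta soc) yb \<mu>b u \<le> ereal (\<eta> \<bullet> u)"
proof -
  define Y V where "Y k = yb + t k *\<^sub>R U k" and "V k = \<mu>b + t k *\<^sub>R E k" for k
  have V: "V k \<in> normal_cone soc (Y k)" for k using graph by (simp add: V_def Y_def)
  have yb: "yb \<in> soc" "- \<mu>b \<in> soc" "\<mu>b \<bullet> yb = 0"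
    using base by (auto simp: normal_cone_soc_iff)
  have Y: "Y k \<in> soc" and mV: "- V k \<in> soc" and VY: "V k \<bullet> Y k = 0" for k
    using V[of k] by (auto simp: normal_cone_soc_iff)
  \<comment> \<open>Both quantities are nonnegative by self-duality, and expanding
    \<open>V k \<bullet> Y k = 0\<close> determines their sum.\<close>
  define a b where "a k = - (\<mu>b \<bullet> U k)" and "b k = - (E k \<bullet> yb)" for k
  have ta: "t k * a k = - (\<mu>b \<bullet> Y k)" for k
    using yb by (simp add: a_def Y_def inner_add_right)
  have tb: "t k * b k = - (V k \<bullet> yb)" for k
    using yb by (simp add: b_def V_def inner_add_left)
  have a: "0 \<le> a k" for k
  proof -
    have "0 \<le> t k * a k" using soc_inner_nonneg[OF yb(2) Y[of k]] by (simp add: ta)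
    then show ?thesis using mult_le_cancel_left_pos[OF t(1)[of k], of 0 "a k"] by simp
  qed
  have b: "0 \<le> b k" for k
  proof -
    have "0 \<le> t k * b k" using soc_inner_nonneg[OF mV[of k] yb(1)] by (simp add: tb)
    then show ?thesis using mult_le_cancel_left_pos[OF t(1)[of k], of 0 "b k"] by simp
  qed
  have ab: "a k + b k = t k * (E k \<bullet> U k)" for k
  proof -
    have "V k \<bullet> Y k = t k * (t k * (E k \<bullet> U k) - (a k + b k))"
      using yb(3) by (simp add: V_def Y_def a_def b_def inner_add_left inner_add_right algebra_simps)
    then show ?thesis using VY[of k] t(1)[of k] by auto
  qed
  have EU: "(\<lambda>k. E k \<bullet> U k) \<longlonglongrightarrow> \<eta> \<bullet> u" by (intro tendsto_intros E U)
  have "a \<longlonglongrightarrow> 0"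
  proof (rule tendsto_sandwich[of "\<lambda>_. 0" _ _ "\<lambda>k. t k * (E k \<bullet> U k)"])
    show "(\<lambda>k. t k * (E k \<bullet> U k)) \<longlonglongrightarrow> 0" using tendsto_mult[OF t(2) EU] by simp
    show "\<forall>\<^sub>F k in sequentially. a k \<le> t k * (E k \<bullet> U k)"
      using ab b by (intro always_eventually) (metis add_increasing2 order_refl)
  qed (use a in auto)
  moreover have "a \<longlonglongrightarrow> - (\<mu>b \<bullet> u)" unfolding a_def by (intro tendsto_intros U)
  ultimately show \<mu>u: "\<mu>b \<bullet> u = 0" using LIMSEQ_unique by fastforce
  \<comment> \<open>The degenerate cases only yield the bound \<open>0\<close>, which this turns
    into the claimed one.\<close>
  have nonneg: "0 \<le> \<eta> \<bullet> u"
  proof (rule LIMSEQ_le_const[OF EU], intro exI allI impI)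
    show "0 \<le> E k \<bullet> U k" for k
      using ab[of k] a[of k] b[of k] t(1)[of k] by (metis add_nonneg_nonneg zero_le_mult_iff not_less)
  qed
  consider "\<mu>b = 0" | "yb = 0" | "\<mu>b \<noteq> 0" "yb \<noteq> 0" by blast
  then show "second_subderivative (delta soc) yb \<mu>b u \<le> ereal (\<eta> \<bullet> u)"
  proof cases
    case 1
    have "second_subderivative (delta soc) yb \<mu>b u \<le> ereal 0"
      by (rule second_subderivative_delta_le[OF t U yb(1), where b = "\<lambda>_. 0"])
        (use Y in \<open>auto simp: Y_def 1\<close>)
    then show ?thesis using nonneg order_trans ereal_less_eq(3) by blast
  next
    case 2
    \<comment> \<open>At the apex feasibility is scale invariant, so the limit direction
      \<open>u\<close> is itself feasible. Being orthogonal to \<open>\<mu>b\<close>, it makes all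
      quotients vanish along the constant sequence.\<close>
    have "U k \<in> soc" for k
      using soc_scaleR[OF _ Y, of "inverse (t k)" k] t(1)[of k] by (simp add: Y_def 2)
    then have "u \<in> soc" using closed_sequentially[OF closed_soc _ U] by blast
    then have "second_subderivative (delta soc) yb \<mu>b u \<le> ereal 0"
      using second_subderivative_delta_le[OF t tendsto_const yb(1), of u \<mu>b "\<lambda>_. 0" 0] t(1) \<mu>u
      by (simp add: 2 soc_scaleR less_imp_le)
    then show ?thesis using nonneg order_trans ereal_less_eq(3) by blast
  next
    case 3
    define s \<sigma> where "s = norm \<mu>b / norm yb" and "\<sigma> k = norm (V k) / norm (Y k)" for k
    have s: "0 < s" using 3 by (simp add: s_def)
    have Yl: "Y \<longlonglongrightarrow> yb" unfolding Y_def using t(2) U by (auto intro!: tendsto_eq_intros)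
    have Vl: "V \<longlonglongrightarrow> \<mu>b" unfolding V_def using t(2) E by (auto intro!: tendsto_eq_intros)
    have \<sigma>: "\<sigma> \<longlonglongrightarrow> s" unfolding \<sigma>_def s_def using 3 by (intro tendsto_intros Yl Vl) auto
    have ev: "\<forall>\<^sub>F k in sequentially. Y k \<noteq> 0 \<and> V k \<noteq> 0"
      using tendsto_imp_eventually_ne[OF Yl 3(2)] tendsto_imp_eventually_ne[OF Vl 3(1)]
      by eventually_elim simp
    have "\<forall>\<^sub>F k in sequentially. 2 * (E k \<bullet> U k) * s / (s + \<sigma> k) = - 2 * (\<mu>b \<bullet> U k) / t k"
      using ev
    proof eventually_elim
      case (elim k)
      have \<mu>beq: "\<mu>b = - s *\<^sub>R (fst yb, - snd yb)"
        unfolding s_def by (rule normal_cone_soc_nonzero[OF base 3])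
      have Veq: "V k = - \<sigma> k *\<^sub>R (fst (Y k), - snd (Y k))"
        unfolding \<sigma>_def using normal_cone_soc_nonzero[OF V] elim by blast
      have \<sigma>pos: "0 \<le> \<sigma> k" by (simp add: \<sigma>_def)
      \<comment> \<open>The reflection is self-adjoint, so \<open>t k * a k\<close> and
        \<open>t k * b k\<close> are multiples of the same number, with factors \<open>s\<close> and
        \<open>\<sigma> k\<close>; the known sum then determines \<open>a k\<close>.\<close>
      define r where "r = (fst (Y k), - snd (Y k)) \<bullet> yb"
      have "t k * b k = \<sigma> k * r" unfolding tb Veq r_def by (simp add: inner_prod_def algebra_simps)
      moreover have "t k * a k = s * r" unfolding ta \<mu>beq r_def
        by (simp add: inner_prod_def inner_commute algebra_simps)
      ultimately have "t k * (s * b k) = t k * (\<sigma> k * a k)" by (simp add: algebra_simps)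
      then have "s * b k = \<sigma> k * a k" using t(1)[of k] by simp
      then have "(s + \<sigma> k) * a k = s * (a k + b k)" by (simp add: algebra_simps)
      then have "(s + \<sigma> k) * a k = s * (t k * (E k \<bullet> U k))" by (simp add: ab)
      then have "(E k \<bullet> U k) * s / (s + \<sigma> k) = a k / t k"
        using t(1)[of k] s \<sigma>pos by (simp add: divide_simps) (auto simp: algebra_simps)
      then show ?case by (simp add: a_def)
    qed
    moreover have "(\<lambda>k. 2 * (E k \<bullet> U k) * s / (s + \<sigma> k)) \<longlonglongrightarrow> 2 * (\<eta> \<bullet> u) * s / (s + s)"
      using s by (intro tendsto_intros EU \<sigma>) auto
    then have "(\<lambda>k. 2 * (E k \<bullet> U k) * s / (s + \<sigma> k)) \<longlonglongrightarrow> \<eta> \<bullet> u"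
      using s by simp
    ultimately have "(\<lambda>k. - 2 * (\<mu>b \<bullet> U k) / t k) \<longlonglongrightarrow> \<eta> \<bullet> u"
      using Lim_transform_eventually by fast
    then show ?thesis
      by (intro second_subderivative_delta_le[OF t U yb(1) _ order_refl])
        (use Y in \<open>auto simp: Y_def\<close>)
  qed
qed

section \<open>Adjoints and gradients\<close>

abbreviation adj :: "('a::euclidean_space \<Rightarrow>\<^sub>L 'b::euclidean_space) \<Rightarrow> 'b \<Rightarrow> 'a" where
  "adj T \<equiv> adjoint (blinfun_apply T)"

lemma inner_adj: "w \<bullet> adj T y = blinfun_apply T w \<bullet> y"
  by (rule adjoint_works) (rule blinfun.bounded_linear_right[THEN bounded_linear.linear])

lemma norm_adj_le: "norm (adj T y) \<le> norm T * norm y"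
proof -
  have "norm (adj T y) * norm (adj T y) = blinfun_apply T (adj T y) \<bullet> y"
    by (metis inner_adj dot_square_norm power2_eq_square)
  also have "\<dots> \<le> norm (blinfun_apply T (adj T y)) * norm y" by (rule norm_cauchy_schwarz)
  also have "\<dots> \<le> norm T * norm (adj T y) * norm y"
    by (intro mult_right_mono norm_blinfun) simp
  finally have "norm (adj T y) * norm (adj T y) \<le> (norm T * norm y) * norm (adj T y)"
    by (simp add: algebra_simps)
  then show ?thesis by (cases "adj T y = 0") auto
qed

text \<open>Lets limits in both arguments, and derivatives of the operator, pass through
  \<open>adj (D x) \<mu>\<close>.\<close>

lemma bounded_bilinear_adj: "bounded_bilinear adj"
proof
  fix S T :: "'a \<Rightarrow>\<^sub>L 'b" and x y :: 'b and r :: real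
  show "adj (S + T) y = adj S y + adj T y"
    by (rule vector_eq_ldot[THEN iffD1], unfold inner_add_right inner_adj)
      (simp add: plus_blinfun.rep_eq inner_add_left)
  show "adj T (x + y) = adj T x + adj T y"
    by (rule vector_eq_ldot[THEN iffD1], unfold inner_add_right inner_adj) simp
  show "adj (r *\<^sub>R T) y = r *\<^sub>R adj T y"
    by (rule vector_eq_ldot[THEN iffD1], unfold inner_scaleR_right inner_adj)
      (simp add: scaleR_blinfun.rep_eq)
  show "adj T (r *\<^sub>R y) = r *\<^sub>R adj T y"
    by (rule vector_eq_ldot[THEN iffD1], unfold inner_scaleR_right inner_adj) simp
next
  show "\<exists>K. \<forall>(T :: 'a \<Rightarrow>\<^sub>L 'b) y. norm (adj T y) \<le> norm T * norm y * K"
    by (intro exI[of _ 1]) (simp add: norm_adj_le)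
qed

lemma GDERIV_unique:
  assumes "GDERIV F x :> a" "GDERIV F x :> b"
  shows "a = b"
proof -
  have "(\<lambda>h. h \<bullet> a) = (\<lambda>h. h \<bullet> b)"
    using assms unfolding gderiv_def by (rule has_derivative_unique)
  then show ?thesis using vector_eq_ldot by metis
qed

lemma grad_eqI: "GDERIV F x :> a \<Longrightarrow> grad F x = a"
  unfolding grad_def by (rule the_equality) (auto intro: GDERIV_unique)

lemma GDERIV_imp_differentiable: "GDERIV F x :> a \<Longrightarrow> F differentiable (at x)"
  unfolding gderiv_def differentiable_def by blast

section \<open>The augmented Lagrangian\<close>

lemma aug_lagrangian_complete_square:
  fixes \<mu> d :: "'a::real_inner"
  assumes "0 < \<rho>"
  shows "\<rho> / 2 * (norm (d + inverse \<rho> *\<^sub>R \<mu>))\<^sup>2 - 1 / 2 * inverse \<rho> * (norm \<mu>)\<^sup>2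
    = \<mu> \<bullet> d + \<rho> / 2 * (norm d)\<^sup>2"
proof -
  have "(norm (d + inverse \<rho> *\<^sub>R \<mu>))\<^sup>2
      = (norm d)\<^sup>2 + 2 * inverse \<rho> * (\<mu> \<bullet> d) + (inverse \<rho>)\<^sup>2 * (norm \<mu>)\<^sup>2"
    by (simp only: power2_norm_eq_inner inner_simps)
      (simp add: inner_commute power2_eq_square algebra_simps)
  then show ?thesis using assms by (simp add: field_simps power2_eq_square)
qed

text \<open>The augmented Lagrangian is the minimum, over cone points \<open>y\<close>, of a
  Lagrangian with quadratic penalty on \<open>\<Phi> x - y\<close>. Any \<open>y\<close> gives an
  upper bound; the projection in \<open>aug_lagrangian_eq\<close> attains it.\<close>

lemma aug_lagrangian_le:
  assumes "0 < \<rho>" "y \<in> soc"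
  shows "aug_lagrangian f \<Phi> x \<mu> \<rho> \<le> f x + \<mu> \<bullet> (\<Phi> x - y) + \<rho> / 2 * (norm (\<Phi> x - y))\<^sup>2"
proof -
  have "infdist (\<Phi> x + inverse \<rho> *\<^sub>R \<mu>) soc \<le> norm ((\<Phi> x - y) + inverse \<rho> *\<^sub>R \<mu>)"
    using infdist_le[OF assms(2), of "\<Phi> x + inverse \<rho> *\<^sub>R \<mu>"] by (simp add: dist_norm algebra_simps)
  then have "\<rho> / 2 * (infdist (\<Phi> x + inverse \<rho> *\<^sub>R \<mu>) soc)\<^sup>2
      \<le> \<rho> / 2 * (norm ((\<Phi> x - y) + inverse \<rho> *\<^sub>R \<mu>))\<^sup>2"
    using assms(1) by (intro mult_left_mono power_mono infdist_nonneg) auto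
  then show ?thesis
    using aug_lagrangian_complete_square[OF assms(1), of "\<Phi> x - y" \<mu>]
    unfolding aug_lagrangian_def by linarith
qed

lemma aug_lagrangian_eq:
  assumes "0 < \<rho>" "y = soc_proj (\<Phi> x + inverse \<rho> *\<^sub>R \<mu>)"
  shows "aug_lagrangian f \<Phi> x \<mu> \<rho> = f x + \<mu> \<bullet> (\<Phi> x - y) + \<rho> / 2 * (norm (\<Phi> x - y))\<^sup>2"
proof -
  have "infdist (\<Phi> x + inverse \<rho> *\<^sub>R \<mu>) soc = norm ((\<Phi> x - y) + inverse \<rho> *\<^sub>R \<mu>)"
    by (simp add: infdist_soc assms(2) algebra_simps)
  then show ?thesis
    using aug_lagrangian_complete_square[OF assms(1), of "\<Phi> x - y" \<mu>]
    unfolding aug_lagrangian_def by simp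
qed

text \<open>The projection for \<open>\<mu>\<close> and \<open>\<rho>\<close> competes in the
  minimum for \<open>\<mu>b\<close> and \<open>\<rho>0\<close>. The excess penalty contributes at
  least \<open>n / 2\<close>, and completing the square against the multiplier difference costs only
  the quadratic error.\<close>

lemma aug_lagrangian_perturb:
  assumes "0 < \<rho>0" "\<rho>0 + 1 \<le> \<rho>"
  shows "aug_lagrangian f \<Phi> x \<mu>b \<rho>0 - (norm (\<mu> - \<mu>b))\<^sup>2 / 2 \<le> aug_lagrangian f \<Phi> x \<mu> \<rho>"
proof -
  define y where "y = soc_proj (\<Phi> x + inverse \<rho> *\<^sub>R \<mu>)"
  define d where "d = \<Phi> x - y"
  define n where "n = (norm d)\<^sup>2"
  have "aug_lagrangian f \<Phi> x \<mu>b \<rho>0 \<le> f x + \<mu>b \<bullet> d + \<rho>0 / 2 * n"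
    unfolding d_def n_def by (rule aug_lagrangian_le) (auto simp: assms y_def soc_proj_in)
  moreover have "aug_lagrangian f \<Phi> x \<mu> \<rho> = f x + \<mu> \<bullet> d + \<rho> / 2 * n"
    unfolding d_def n_def using assms by (intro aug_lagrangian_eq) (auto simp: y_def)
  moreover have "\<rho>0 / 2 * n + n / 2 \<le> \<rho> / 2 * n"
  proof -
    have "(\<rho>0 + 1) * n \<le> \<rho> * n"
      using assms by (intro mult_right_mono) (auto simp: n_def)
    then show ?thesis by (simp add: distrib_right)
  qed
  moreover have "0 \<le> (norm ((\<mu> - \<mu>b) + d))\<^sup>2" by simp
  then have "0 \<le> (norm (\<mu> - \<mu>b))\<^sup>2 + 2 * (\<mu> \<bullet> d - \<mu>b \<bullet> d) + n"
    unfolding n_def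
    by (simp only: power2_norm_eq_inner inner_simps) (simp add: inner_commute algebra_simps)
  ultimately show ?thesis by argo
qed

lemma aug_lagrangian_feasible_le:
  assumes "0 < \<rho>" "\<Phi> x \<in> soc"
  shows "aug_lagrangian f \<Phi> x \<mu> \<rho> \<le> f x"
  using aug_lagrangian_le[OF assms, where f = f and \<mu> = \<mu> and \<Phi> = \<Phi> and x = x] by simp

lemma aug_lagrangian_KKT_point:
  assumes "0 < \<rho>" "\<mu> \<in> normal_cone soc (\<Phi> x)"
  shows "aug_lagrangian f \<Phi> x \<mu> \<rho> = f x"
proof -
  have "inverse \<rho> *\<^sub>R \<mu> \<in> normal_cone soc (\<Phi> x)"
    using assms by (intro normal_cone_soc_scaleR) auto
  then have "soc_proj (\<Phi> x + inverse \<rho> *\<^sub>R \<mu>) = \<Phi> x" by (rule soc_proj_eqI)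
  then show ?thesis
    using aug_lagrangian_eq[OF assms(1) refl, where f = f and \<Phi> = \<Phi> and x = x and \<mu> = \<mu>] by simp
qed

text \<open>The chain rule produces the gradient of the ordinary Lagrangian at the updated
  multiplier \<open>\<rho> *\<^sub>R (z - soc_proj z)\<close>, so a stationary point of the
  subproblem is stationary for the new multiplier.\<close>

lemma GDERIV_aug_lagrangian:
  fixes \<Phi> :: "'a::euclidean_space \<Rightarrow> real \<times> (real^'m)"
  assumes "0 < \<rho>" "GDERIV f x :> g" "(\<Phi> has_derivative blinfun_apply D) (at x)"
    and z_def: "z = \<Phi> x + inverse \<rho> *\<^sub>R \<mu>"
  shows "GDERIV (\<lambda>x. aug_lagrangian f \<Phi> x \<mu> \<rho>) x :> g + adj D (\<rho> *\<^sub>R (z - soc_proj z))"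
proof -
  have z: "((\<lambda>x. \<Phi> x + inverse \<rho> *\<^sub>R \<mu>) has_derivative blinfun_apply D) (at x)"
    using has_derivative_add[OF assms(3) has_derivative_const] by simp
  have "((\<lambda>z. (infdist z soc)\<^sup>2) has_derivative (\<lambda>h. h \<bullet> (2 *\<^sub>R (z - soc_proj z))))
      (at (\<Phi> x + inverse \<rho> *\<^sub>R \<mu>))"
    using GDERIV_infdist_soc_squared[of z] by (simp add: gderiv_def z_def)
  from has_derivative_compose[OF z this]
  have "((\<lambda>x. (infdist (\<Phi> x + inverse \<rho> *\<^sub>R \<mu>) soc)\<^sup>2) has_derivative
      (\<lambda>h. blinfun_apply D h \<bullet> (2 *\<^sub>R (z - soc_proj z)))) (at x)" .
  then have "((\<lambda>x. aug_lagrangian f \<Phi> x \<mu> \<rho>) has_derivative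
      (\<lambda>h. h \<bullet> g + \<rho> / 2 * (blinfun_apply D h \<bullet> (2 *\<^sub>R (z - soc_proj z))) - 0)) (at x)"
    unfolding aug_lagrangian_def
    by (intro has_derivative_diff has_derivative_add has_derivative_mult_right has_derivative_const
        assms(2)[unfolded gderiv_def])
  moreover have "(\<lambda>h. h \<bullet> g + \<rho> / 2 * (blinfun_apply D h \<bullet> (2 *\<^sub>R (z - soc_proj z))) - 0)
      = (\<lambda>h. h \<bullet> (g + adj D (\<rho> *\<^sub>R (z - soc_proj z))))"
    by (simp add: fun_eq_iff inner_add_right inner_adj)
  ultimately show ?thesis by (simp add: gderiv_def)
qed

lemma GDERIV_lagrangian:
  fixes \<Phi> :: "'a::euclidean_space \<Rightarrow> 'b::euclidean_space"
  assumes "GDERIV f x :> g" "(\<Phi> has_derivative blinfun_apply D) (at x)"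
  shows "GDERIV (\<lambda>x. lagrangian f \<Phi> x \<mu>) x :> g + adj D \<mu>"
  unfolding gderiv_def lagrangian_def inner_add_right inner_adj inner_commute[of _ \<mu>]
  by (intro has_derivative_add has_derivative_inner_right assms(2) assms(1)[unfolded gderiv_def])

section \<open>Expansions along sequences\<close>

lemma has_derivative_local_bound:
  fixes F :: "'a::real_normed_vector \<Rightarrow> 'b::real_normed_vector"
  assumes "(F has_derivative F') (at a)"
  shows "\<exists>K>0. \<exists>d>0. \<forall>x. norm (x - a) < d \<longrightarrow> norm (F x - F a) \<le> K * norm (x - a)"
proof -
  from assms obtain B where B: "0 < B" "\<And>h. norm (F' h) \<le> norm h * B"
    using bounded_linear.pos_bounded has_derivative_bounded_linear by metis
  from assms obtain d where d: "0 < d"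
    "\<And>x. norm (x - a) < d \<Longrightarrow> norm (F x - F a - F' (x - a)) \<le> 1 * norm (x - a)"
    unfolding has_derivative_at_alt using zero_less_one by metis
  have "norm (F x - F a) \<le> (1 + B) * norm (x - a)" if "norm (x - a) < d" for x
  proof -
    have "norm (F x - F a) \<le> norm (F x - F a - F' (x - a)) + norm (F' (x - a))"
      using norm_triangle_ineq[of "F x - F a - F' (x - a)" "F' (x - a)"] by simp
    also have "\<dots> \<le> 1 * norm (x - a) + norm (x - a) * B"
      by (intro add_mono d(2) B(2) that)
    finally show ?thesis by (simp add: algebra_simps)
  qed
  then show ?thesis using B(1) d(1) by (intro exI[of _ "1 + B"] exI[of _ d]) auto
qed

lemma tendsto_of_dist_le_inverse_Suc:
  fixes X :: "nat \<Rightarrow> 'c::real_normed_vector"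
  assumes "\<And>n. norm (X n - a) < 1 / real (Suc n)"
  shows "X \<longlonglongrightarrow> a"
proof (rule LIM_zero_cancel, rule tendsto_norm_zero_cancel)
  have "(\<lambda>n. 1 / real (Suc n)) \<longlonglongrightarrow> 0"
    using LIMSEQ_inverse_real_of_nat by (simp add: inverse_eq_divide)
  then show "(\<lambda>n. norm (X n - a)) \<longlonglongrightarrow> 0"
    by (rule tendsto_sandwich[OF _ _ tendsto_const, rotated 2])
      (use assms in \<open>auto simp: less_imp_le\<close>)
qed

lemma unit_direction_subsequence:
  fixes X :: "nat \<Rightarrow> 'a::euclidean_space"
  assumes "\<And>n. X n \<noteq> a"
  shows "\<exists>r \<xi>. strict_mono r \<and> norm \<xi> = 1 \<and>
    (\<lambda>n. inverse (norm (X (r n) - a)) *\<^sub>R (X (r n) - a)) \<longlonglongrightarrow> \<xi>"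
proof -
  have "\<forall>n. inverse (norm (X n - a)) *\<^sub>R (X n - a) \<in> sphere 0 1"
    using assms by simp
  then obtain \<xi> r where "\<xi> \<in> sphere 0 1" "strict_mono (r :: nat \<Rightarrow> nat)"
    "((\<lambda>n. inverse (norm (X n - a)) *\<^sub>R (X n - a)) \<circ> r) \<longlonglongrightarrow> \<xi>"
    using compact_sphere[of "0 :: 'a" 1] unfolding compact_def by meson
  then show ?thesis by (auto simp: o_def)
qed

text \<open>The setting shared by the contradiction arguments for growth and for the error bound:
  points tending to \<open>a\<close> whose normalised errors have a limit direction
  \<open>\<xi>\<close>.\<close>

locale directional_sequence =
  fixes X :: "nat \<Rightarrow> 'a::euclidean_space" and a \<xi> :: 'a and t :: "nat \<Rightarrow> real"
  assumes X_lim: "X \<longlonglongrightarrow> a" and X_neq: "X n \<noteq> a"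
    and t_def: "t = (\<lambda>n. norm (X n - a))"
    and dir: "(\<lambda>n. inverse (t n) *\<^sub>R (X n - a)) \<longlonglongrightarrow> \<xi>"
begin

lemma t_pos: "0 < t n"
  using X_neq by (simp add: t_def)

lemma t_lim: "t \<longlonglongrightarrow> 0"
  unfolding t_def using tendsto_norm[OF X_lim[THEN LIM_zero]] by simp

lemma derivative_quotient:
  fixes F :: "'a \<Rightarrow> 'b::real_normed_vector"
  assumes "(F has_derivative F') (at a)"
  shows "(\<lambda>n. inverse (t n) *\<^sub>R (F (X n) - F a)) \<longlonglongrightarrow> F' \<xi>"
proof -
  interpret F': bounded_linear F' using assms by (rule has_derivative_bounded_linear)
  have "filterlim X (at a) sequentially"
    using X_lim X_neq by (simp add: filterlim_at)
  moreover have "((\<lambda>y. (1 / norm (y - a)) *\<^sub>R (F y - (F a + F' (y - a)))) \<longlongrightarrow> 0) (at a)"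
    using assms by (simp add: has_derivative_within)
  ultimately have "(\<lambda>n. (1 / norm (X n - a)) *\<^sub>R (F (X n) - (F a + F' (X n - a)))) \<longlonglongrightarrow> 0"
    using filterlim_compose by fast
  moreover have "(1 / norm (X n - a)) *\<^sub>R (F (X n) - (F a + F' (X n - a)))
      + F' (inverse (t n) *\<^sub>R (X n - a)) = inverse (t n) *\<^sub>R (F (X n) - F a)" for n
    by (simp only: t_def F'.scaleR inverse_eq_divide scaleR_add_right[symmetric]) simp
  ultimately show ?thesis using tendsto_add[OF _ F'.tendsto[OF dir]] by fastforce
qed

text \<open>Subtract the quadratic model and apply the mean value theorem along the segment from
  \<open>a\<close>. As \<open>g\<close> vanishes at \<open>a\<close>, the derivative met there is
  the linearisation error of \<open>g\<close>, which is small by differentiability at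
  \<open>a\<close>.\<close>

lemma second_order_quotient:
  assumes "0 < r" "\<And>x. x \<in> ball a r \<Longrightarrow> GDERIV F x :> g x" "(g has_derivative H) (at a)" "g a = 0"
  shows "(\<lambda>n. (F (X n) - F a) / (t n)\<^sup>2) \<longlonglongrightarrow> (H \<xi> \<bullet> \<xi>) / 2"
proof -
  interpret H: bounded_linear H using assms(3) by (rule has_derivative_bounded_linear)
  define h where "h n = X n - a" for n
  have "(\<lambda>n. (F (X n) - F a) / (t n)\<^sup>2 - (H (inverse (t n) *\<^sub>R h n) \<bullet> (inverse (t n) *\<^sub>R h n)) / 2)
      \<longlonglongrightarrow> 0"
  proof (rule LIMSEQ_I)
    fix e :: real assume "0 < e"
    then obtain d where d: "0 < d"
      "\<And>y. norm (y - a) < d \<Longrightarrow> norm (g y - g a - H (y - a)) \<le> (e / 2) * norm (y - a)"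
      using assms(3) unfolding has_derivative_at_alt by (metis half_gt_zero)
    have "\<forall>\<^sub>F n in sequentially. norm (X n - a) < min d r"
      using t_lim[unfolded t_def] d(1) assms(1) by (intro order_tendstoD(2)) auto
    then obtain N where N: "\<And>n. N \<le> n \<Longrightarrow> norm (h n) < d \<and> norm (h n) < r"
      unfolding eventually_sequentially h_def by auto
    have "\<bar>(F (X n) - F a) / (t n)\<^sup>2
        - (H (inverse (t n) *\<^sub>R h n) \<bullet> (inverse (t n) *\<^sub>R h n)) / 2\<bar> < e" if "N \<le> n" for n
    proof -
      define \<phi> where "\<phi> s = F (a + s *\<^sub>R h n) - s\<^sup>2 / 2 * (H (h n) \<bullet> h n)" for s
      define \<phi>' where "\<phi>' s = h n \<bullet> g (a + s *\<^sub>R h n) - s * (H (h n) \<bullet> h n)" for s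
      have small: "norm (s *\<^sub>R h n) \<le> norm (h n)" if "0 \<le> s" "s \<le> 1" for s
        using that by (simp add: mult_left_le_one_le)
      have \<phi>: "(\<phi> has_real_derivative \<phi>' s) (at s)" if s: "0 \<le> s" "s \<le> 1" for s
      proof -
        have "a + s *\<^sub>R h n \<in> ball a r"
          using small[OF s] N[OF \<open>N \<le> n\<close>] by (simp add: dist_norm)
        then have "(F has_derivative (\<lambda>v. v \<bullet> g (a + s *\<^sub>R h n))) (at (a + s *\<^sub>R h n))"
          using assms(2) by (simp add: gderiv_def)
        moreover have "((\<lambda>s. a + s *\<^sub>R h n) has_derivative (\<lambda>v. v *\<^sub>R h n)) (at s)"
          by (auto intro!: derivative_eq_intros)
        ultimately have "((\<lambda>s. F (a + s *\<^sub>R h n)) has_derivative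
            (\<lambda>v. (v *\<^sub>R h n) \<bullet> g (a + s *\<^sub>R h n))) (at s)"
          using has_derivative_compose by fast
        then have "((\<lambda>s. F (a + s *\<^sub>R h n)) has_real_derivative h n \<bullet> g (a + s *\<^sub>R h n)) (at s)"
          by (simp add: has_field_derivative_def mult_commute_abs)
        then show ?thesis
          unfolding \<phi>_def \<phi>'_def by (auto intro!: derivative_eq_intros)
      qed
      obtain s where s: "0 < s" "s < 1" "\<phi> 1 - \<phi> 0 = \<phi>' s"
        using MVT2[of 0 1 \<phi> \<phi>'] \<phi> by auto
      have "\<phi>' s = h n \<bullet> (g (a + s *\<^sub>R h n) - g a - H ((a + s *\<^sub>R h n) - a))"
        by (simp add: \<phi>'_def assms(4) H.scaleR inner_diff_right inner_commute)
      also have "\<bar>\<dots>\<bar> \<le> norm (h n) * norm (g (a + s *\<^sub>R h n) - g a - H ((a + s *\<^sub>R h n) - a))"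
        by (rule Cauchy_Schwarz_ineq2)
      also have "\<dots> \<le> norm (h n) * ((e / 2) * norm ((a + s *\<^sub>R h n) - a))"
        using small[of s] s N[OF that] by (intro mult_left_mono d(2)) auto
      also have "\<dots> \<le> norm (h n) * ((e / 2) * norm (h n))"
        using small[of s] s \<open>0 < e\<close> by (intro mult_left_mono) auto
      finally have bound: "\<bar>\<phi> 1 - \<phi> 0\<bar> \<le> (e / 2) * (t n)\<^sup>2"
        by (simp add: s(3) t_def h_def power2_eq_square algebra_simps)
      have "(F (X n) - F a) / (t n)\<^sup>2 - (H (inverse (t n) *\<^sub>R h n) \<bullet> (inverse (t n) *\<^sub>R h n)) / 2
          = (\<phi> 1 - \<phi> 0) / (t n)\<^sup>2"
      proof -
        have "H (inverse (t n) *\<^sub>R h n) \<bullet> (inverse (t n) *\<^sub>R h n) = (H (h n) \<bullet> h n) / (t n)\<^sup>2"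
          unfolding H.scaleR inner_scaleR_left inner_scaleR_right
          by (simp add: power2_eq_square divide_inverse)
        moreover have "\<phi> 1 - \<phi> 0 = F (X n) - F a - (H (h n) \<bullet> h n) / 2"
          by (simp add: \<phi>_def h_def)
        ultimately show ?thesis by (simp only: diff_divide_distrib) simp
      qed
      moreover have "\<bar>(\<phi> 1 - \<phi> 0) / (t n)\<^sup>2\<bar> \<le> e / 2"
        using bound t_pos[of n] by (simp add: abs_divide divide_le_eq)
      ultimately show ?thesis using \<open>0 < e\<close> by linarith
    qed
    then show "\<exists>N. \<forall>n\<ge>N. norm ((F (X n) - F a) / (t n)\<^sup>2
        - (H (inverse (t n) *\<^sub>R h n) \<bullet> (inverse (t n) *\<^sub>R h n)) / 2 - 0) < e"
      by auto
  qed
  moreover have "(\<lambda>n. (H (inverse (t n) *\<^sub>R h n) \<bullet> (inverse (t n) *\<^sub>R h n)) / 2) \<longlonglongrightarrow> (H \<xi> \<bullet> \<xi>) / 2"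
    unfolding h_def by (intro tendsto_intros H.tendsto dir) auto
  ultimately show ?thesis using tendsto_add by fastforce
qed

end

section \<open>Consequences of the second-order condition and of calmness\<close>

locale soc_program =
  fixes f :: "real^'n \<Rightarrow> real" and \<Phi> :: "real^'n \<Rightarrow> real \<times> (real^'m)"
    and xb :: "real^'n" and \<mu>b :: "real \<times> (real^'m)" and r :: real
    and Df :: "real^'n \<Rightarrow> (real^'n) \<Rightarrow>\<^sub>L real" and D :: "real^'n \<Rightarrow> (real^'n) \<Rightarrow>\<^sub>L (real \<times> (real^'m))"
    and Df' :: "real^'n \<Rightarrow> (real^'n) \<Rightarrow>\<^sub>L real" and D' :: "real^'n \<Rightarrow> (real^'n) \<Rightarrow>\<^sub>L (real \<times> (real^'m))"
  assumes r: "0 < r"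
    and Df: "x \<in> ball xb r \<Longrightarrow> (f has_derivative blinfun_apply (Df x)) (at x)"
    and D: "x \<in> ball xb r \<Longrightarrow> (\<Phi> has_derivative blinfun_apply (D x)) (at x)"
    and Df': "(Df has_derivative Df') (at xb)"
    and D': "(D has_derivative D') (at xb)"
    and multipliers_eq: "multipliers f \<Phi> xb = {\<mu>b}"
    and SOSC: "SOSC f \<Phi> xb \<mu>b"
    and calm: "calm_at (multiplier_map f \<Phi> xb) (0, 0) \<mu>b"
begin

lemma xb_in: "xb \<in> ball xb r"
  using r by simp

text \<open>The gradient of the Lagrangian in \<open>x\<close>; the summand
  \<open>adj (Df x) 1\<close> is the gradient of \<open>f\<close>.\<close>

definition G :: "real^'n \<Rightarrow> real \<times> (real^'m) \<Rightarrow> real^'n" where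
  "G x \<mu> = adj (Df x) 1 + adj (D x) \<mu>"

text \<open>The Hessian of the Lagrangian at \<open>xb\<close> and \<open>\<mu>b\<close>, applied to
  \<open>h\<close>; see \<open>hess_eq\<close>.\<close>

definition H :: "real^'n \<Rightarrow> real^'n" where
  "H h = adj (Df' h) 1 + adj (D' h) \<mu>b"

lemma GDERIV_f: "x \<in> ball xb r \<Longrightarrow> GDERIV f x :> adj (Df x) 1"
  using Df by (simp add: gderiv_def inner_adj)

lemma GDERIV_lagrangian_G: "x \<in> ball xb r \<Longrightarrow> GDERIV (\<lambda>x. lagrangian f \<Phi> x \<mu>) x :> G x \<mu>"
  unfolding G_def by (intro GDERIV_lagrangian GDERIV_f D)

lemma grad_lagrangian: "x \<in> ball xb r \<Longrightarrow> grad (\<lambda>x. lagrangian f \<Phi> x \<mu>) x = G x \<mu>"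
  by (intro grad_eqI GDERIV_lagrangian_G)

lemma adj_Df_derivative: "((\<lambda>x. adj (Df x) 1) has_derivative (\<lambda>h. adj (Df' h) 1)) (at xb)"
  by (rule bounded_linear.has_derivative[OF bounded_bilinear.bounded_linear_left[OF bounded_bilinear_adj] Df'])

lemma adj_D_derivative: "((\<lambda>x. adj (D x) \<mu>) has_derivative (\<lambda>h. adj (D' h) \<mu>)) (at xb)"
  by (rule bounded_linear.has_derivative[OF bounded_bilinear.bounded_linear_left[OF bounded_bilinear_adj] D'])

lemma G_derivative: "((\<lambda>x. G x \<mu>b) has_derivative H) (at xb)"
  unfolding G_def H_def by (intro has_derivative_add adj_Df_derivative adj_D_derivative)

lemma hess_eq: "hess (\<lambda>x. lagrangian f \<Phi> x \<mu>b) xb = H"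
proof -
  have "(grad (\<lambda>x. lagrangian f \<Phi> x \<mu>b) has_derivative H) (at xb)"
    by (rule has_derivative_transform_within_open[OF G_derivative open_ball xb_in])
      (simp add: grad_lagrangian)
  then show ?thesis unfolding hess_def by (rule frechet_derivative_at[symmetric])
qed

lemma frechet_\<Phi>: "frechet_derivative \<Phi> (at xb) = blinfun_apply (D xb)"
  by (rule frechet_derivative_at[OF D[OF xb_in], symmetric])

lemma multiplier_iff: "G xb \<mu> = 0 \<and> \<mu> \<in> normal_cone soc (\<Phi> xb) \<longleftrightarrow> \<mu> = \<mu>b"
  using multipliers_eq by (auto simp: multipliers_def grad_lagrangian[OF xb_in])

lemma G_xb: "G xb \<mu>b = 0" and \<mu>b_normal: "\<mu>b \<in> normal_cone soc (\<Phi> xb)"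
  using multiplier_iff[of \<mu>b] by simp_all

lemma \<mu>b_facts: "\<Phi> xb \<in> soc" "- \<mu>b \<in> soc" "\<mu>b \<bullet> \<Phi> xb = 0"
  using \<mu>b_normal by (auto simp: normal_cone_soc_iff)

text \<open>The form in which both limit arguments meet SOSC: the feasible points
  \<open>\<Phi> xb + t k *\<^sub>R U k\<close> make the limit direction tangent, and
  \<open>c\<close> is the bound on the second subderivative that the sequence provides.\<close>

lemma SOSC_contradiction:
  assumes "h \<noteq> 0" and t: "\<And>k. 0 < t k" "t \<longlonglongrightarrow> 0" and U: "U \<longlonglongrightarrow> blinfun_apply (D xb) h"
    and feas: "\<And>k. \<Phi> xb + t k *\<^sub>R U k \<in> soc"
    and orth: "\<mu>b \<bullet> blinfun_apply (D xb) h = 0"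
    and le: "second_subderivative (delta soc) (\<Phi> xb) \<mu>b (blinfun_apply (D xb) h) \<le> ereal c"
    and c: "H h \<bullet> h + c \<le> 0"
  shows False
proof -
  have "blinfun_apply (D xb) h \<in> critical_cone soc (\<Phi> xb) \<mu>b"
    unfolding critical_cone_def tangent_cone_def using t U feas orth by blast
  then have "0 < ereal (H h \<bullet> h) + second_subderivative (delta soc) (\<Phi> xb) \<mu>b (blinfun_apply (D xb) h)"
    using SOSC assms(1) unfolding SOSC_def hess_eq frechet_\<Phi> by blast
  also have "\<dots> \<le> ereal (H h \<bullet> h) + ereal c" by (intro add_left_mono le)
  finally show False using c by simp
qed

lemma \<Phi>_continuous: "isCont \<Phi> xb"
  using D[OF xb_in] by (rule has_derivative_continuous)

section \<open>Quadratic growth of the augmented Lagrangian\<close>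

text \<open>If growth failed, the normalised error \<open>x - xb\<close> along a sequence of violations with
  penalties tending to infinity would accumulate at a critical direction contradicting SOSC.\<close>
lemma aug_lagrangian_growth:
  "\<exists>\<rho>0>0. \<exists>c>0. \<exists>d>0. \<forall>x. norm (x - xb) \<le> d \<longrightarrow>
     f xb + c * (norm (x - xb))\<^sup>2 \<le> aug_lagrangian f \<Phi> x \<mu>b \<rho>0"
proof (rule ccontr)
  assume neg: "\<not> ?thesis"
  \<comment> \<open>The negated growth is used with penalty \<open>Suc n\<close> and with
    \<open>1 / Suc n\<close> both as growth constant and as radius.\<close>
  have "\<exists>x. norm (x - xb) \<le> 1 / real (Suc n) \<and>
      aug_lagrangian f \<Phi> x \<mu>b (real (Suc n)) < f xb + 1 / real (Suc n) * (norm (x - xb))\<^sup>2" for n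
  proof -
    have p: "0 < real (Suc n)" "0 < 1 / real (Suc n)" by simp_all
    show ?thesis using neg p by (meson not_le)
  qed
  then obtain X0 where X0: "\<And>n. norm (X0 n - xb) \<le> 1 / real (Suc n)"
    "\<And>n. aug_lagrangian f \<Phi> (X0 n) \<mu>b (real (Suc n)) < f xb + 1 / real (Suc n) * (norm (X0 n - xb))\<^sup>2"
    by metis
  have X0_ne: "X0 n \<noteq> xb" for n
    using X0(2)[of n] aug_lagrangian_KKT_point[of "real (Suc n)" \<mu>b \<Phi> xb f] \<mu>b_normal by auto
  have inv: "(\<lambda>n. 1 / real (Suc n)) \<longlonglongrightarrow> 0"
    using LIMSEQ_inverse_real_of_nat by (simp add: inverse_eq_divide)
  have X0_lim: "X0 \<longlonglongrightarrow> xb"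
  proof (rule LIM_zero_cancel, rule tendsto_norm_zero_cancel)
    show "(\<lambda>n. norm (X0 n - xb)) \<longlonglongrightarrow> 0"
      by (rule tendsto_sandwich[OF _ _ tendsto_const inv]) (use X0(1) in auto)
  qed
  obtain q \<xi> where q: "strict_mono q" "norm \<xi> = 1"
    "(\<lambda>n. inverse (norm (X0 (q n) - xb)) *\<^sub>R (X0 (q n) - xb)) \<longlonglongrightarrow> \<xi>"
    using unit_direction_subsequence[of X0 xb, OF X0_ne] by blast
  define X t where "X = X0 \<circ> q" and "t = (\<lambda>n. norm (X n - xb))"
  define \<rho> where "\<rho> n = real (Suc (q n))" for n
  interpret directional_sequence X xb \<xi> t
    using q X0_ne LIMSEQ_subseq_LIMSEQ[OF X0_lim q(1)] by unfold_locales (auto simp: X_def t_def)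
  have \<rho>: "1 \<le> \<rho> n" for n by (simp add: \<rho>_def)
  have \<rho>_lim: "(\<lambda>n. 1 / \<rho> n) \<longlonglongrightarrow> 0"
    using LIMSEQ_subseq_LIMSEQ[OF inv q(1)] by (simp add: \<rho>_def o_def)
  define y where "y n = soc_proj (\<Phi> (X n) + inverse (\<rho> n) *\<^sub>R \<mu>b)" for n
  \<comment> \<open>The scaled violation splits into the Lagrangian increment \<open>Q\<close>, the
    complementarity gap \<open>\<alpha>\<close> and the squared relative distance
    \<open>\<beta>\<close> between \<open>\<Phi>\<close> and \<open>y\<close>. The last two are
    nonnegative, so each can be bounded separately.\<close>
  define Q where "Q n = (lagrangian f \<Phi> (X n) \<mu>b - lagrangian f \<Phi> xb \<mu>b) / (t n)\<^sup>2" for n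
  define \<alpha> \<beta> where "\<alpha> n = - (\<mu>b \<bullet> y n) / (t n)\<^sup>2" and "\<beta> n = (norm (\<Phi> (X n) - y n) / t n)\<^sup>2" for n
  have y: "y n \<in> soc" for n by (simp add: y_def soc_proj_in)
  have \<alpha>0: "0 \<le> \<alpha> n" for n
    using soc_inner_nonneg[OF \<mu>b_facts(2) y[of n]] by (simp add: \<alpha>_def divide_nonpos_nonneg)
  have \<beta>0: "0 \<le> \<beta> n" for n by (simp add: \<beta>_def)
  have key: "Q n + \<alpha> n + \<rho> n * \<beta> n / 2 < 1 / \<rho> n" for n
  proof -
    have "f (X n) + \<mu>b \<bullet> (\<Phi> (X n) - y n) + \<rho> n / 2 * (norm (\<Phi> (X n) - y n))\<^sup>2
        < f xb + 1 / \<rho> n * (t n)\<^sup>2"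
      using X0(2)[of "q n"] aug_lagrangian_eq[of "\<rho> n" "y n" \<Phi> "X n" \<mu>b f] \<rho>[of n]
      by (simp add: y_def X_def t_def \<rho>_def)
    moreover have "lagrangian f \<Phi> xb \<mu>b = f xb" by (simp add: lagrangian_def \<mu>b_facts)
    ultimately have "(lagrangian f \<Phi> (X n) \<mu>b - lagrangian f \<Phi> xb \<mu>b) + - (\<mu>b \<bullet> y n)
        + \<rho> n / 2 * (norm (\<Phi> (X n) - y n))\<^sup>2 < 1 / \<rho> n * (t n)\<^sup>2"
      by (simp add: lagrangian_def inner_diff_right)
    then have "((lagrangian f \<Phi> (X n) \<mu>b - lagrangian f \<Phi> xb \<mu>b) + - (\<mu>b \<bullet> y n)
        + \<rho> n / 2 * (norm (\<Phi> (X n) - y n))\<^sup>2) / (t n)\<^sup>2 < 1 / \<rho> n"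
      using t_pos[of n] by (simp add: divide_less_eq)
    then show ?thesis
      unfolding Q_def \<alpha>_def \<beta>_def power_divide add_divide_distrib by simp
  qed
  have Q: "Q \<longlonglongrightarrow> (H \<xi> \<bullet> \<xi>) / 2"
    unfolding Q_def by (rule second_order_quotient[OF r GDERIV_lagrangian_G G_derivative G_xb])
  \<comment> \<open>\<open>B\<close> bounds \<open>2 * \<alpha>\<close> and has the limit needed to
    contradict SOSC; dividing it by the growing penalty sends \<open>\<beta>\<close> to
    \<open>0\<close>.\<close>
  define B where "B n = 2 * (1 / \<rho> n - Q n)" for n
  have B: "B \<longlonglongrightarrow> - (H \<xi> \<bullet> \<xi>)"
    unfolding B_def using tendsto_mult[OF tendsto_const[of 2] tendsto_diff[OF \<rho>_lim Q]] by simp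
  have \<rho>\<beta>: "0 \<le> \<rho> n * \<beta> n" for n using \<rho>[of n] \<beta>0[of n] by simp
  have \<alpha>B: "2 * \<alpha> n \<le> B n" for n
    using key[of n] \<rho>\<beta>[of n] unfolding B_def by argo
  have \<beta>B: "\<beta> n \<le> B n * (1 / \<rho> n)" for n
  proof -
    have "\<beta> n * \<rho> n \<le> B n" using key[of n] \<alpha>0[of n] unfolding B_def by (simp add: mult.commute)
    then show ?thesis using \<rho>[of n] by (simp add: le_divide_eq)
  qed
  have "(\<lambda>n. B n * (1 / \<rho> n)) \<longlonglongrightarrow> 0" using tendsto_mult[OF B \<rho>_lim] by simp
  then have "\<beta> \<longlonglongrightarrow> 0"
    by (rule tendsto_sandwich[OF _ _ tendsto_const, rotated 2]) (use \<beta>0 \<beta>B in auto)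
  then have "(\<lambda>n. sqrt (\<beta> n)) \<longlonglongrightarrow> 0" using tendsto_real_sqrt by fastforce
  then have "(\<lambda>n. norm (inverse (t n) *\<^sub>R (\<Phi> (X n) - y n))) \<longlonglongrightarrow> 0"
    using t_pos by (simp add: \<beta>_def divide_inverse_commute less_imp_le abs_of_pos)
  then have "(\<lambda>n. inverse (t n) *\<^sub>R (\<Phi> (X n) - y n)) \<longlonglongrightarrow> 0"
    by (rule tendsto_norm_zero_cancel)
  \<comment> \<open>The distance from \<open>y n\<close> to \<open>\<Phi> (X n)\<close> is
    negligible against \<open>t n\<close>, so the feasible points \<open>y n\<close> inherit the
    directional derivative of \<open>\<Phi>\<close>.\<close>
  from tendsto_diff[OF derivative_quotient[OF D[OF xb_in]] this]
  have U: "(\<lambda>n. inverse (t n) *\<^sub>R (y n - \<Phi> xb)) \<longlonglongrightarrow> blinfun_apply (D xb) \<xi>"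
    by (simp flip: scaleR_diff_right)
  have \<mu>U: "\<mu>b \<bullet> (inverse (t n) *\<^sub>R (y n - \<Phi> xb)) = - (\<alpha> n * t n)" for n
    using t_pos[of n] by (simp add: \<alpha>_def inner_diff_right \<mu>b_facts power2_eq_square field_simps)
  have feas: "\<Phi> xb + t n *\<^sub>R (inverse (t n) *\<^sub>R (y n - \<Phi> xb)) \<in> soc" for n
    using t_pos[of n] y[of n] by simp
  have le: "second_subderivative (delta soc) (\<Phi> xb) \<mu>b (blinfun_apply (D xb) \<xi>) \<le> ereal (- (H \<xi> \<bullet> \<xi>))"
  proof (rule second_subderivative_delta_le[OF t_pos t_lim U \<mu>b_facts(1) feas _ B])
    show "- 2 * (\<mu>b \<bullet> (inverse (t n) *\<^sub>R (y n - \<Phi> xb))) / t n \<le> B n" for n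
      unfolding \<mu>U using \<alpha>B[of n] t_pos[of n] by simp
  qed
  have "(\<lambda>n. \<alpha> n * t n) \<longlonglongrightarrow> 0"
  proof (rule tendsto_sandwich[OF _ _ tendsto_const])
    show "(\<lambda>n. B n / 2 * t n) \<longlonglongrightarrow> 0"
      using tendsto_mult[OF tendsto_divide[OF B tendsto_const[of 2]] t_lim] by simp
    show "\<forall>\<^sub>F n in sequentially. \<alpha> n * t n \<le> B n / 2 * t n"
      using \<alpha>B t_pos by (intro always_eventually allI mult_right_mono) (auto simp: less_imp_le field_simps)
  qed (use \<alpha>0 t_pos in \<open>auto simp: less_imp_le\<close>)
  then have "(\<lambda>n. \<mu>b \<bullet> (inverse (t n) *\<^sub>R (y n - \<Phi> xb))) \<longlonglongrightarrow> 0"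
    unfolding \<mu>U using tendsto_minus by fastforce
  then have orth: "\<mu>b \<bullet> blinfun_apply (D xb) \<xi> = 0"
    using LIMSEQ_unique tendsto_inner[OF tendsto_const U] by blast
  have "\<xi> \<noteq> 0" using q(2) by auto
  from SOSC_contradiction[OF this t_pos t_lim U feas orth le] show False by simp
qed

section \<open>Stability of the multipliers and the KKT error bound\<close>

lemma G_diff: "G x \<mu> - G x \<mu>' = adj (D x) (\<mu> - \<mu>')"
  by (simp add: G_def bounded_bilinear.diff_right[OF bounded_bilinear_adj])

text \<open>\<open>G\<close> is affine in the multiplier, so a constant growing linearly in
  \<open>norm \<mu>\<close> works for all multipliers on one neighbourhood.\<close>

lemma G_local_lipschitz:
  "\<exists>K>0. \<exists>d>0. \<forall>x \<mu>. norm (x - xb) < d \<longrightarrow>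
     norm (G x \<mu> - G xb \<mu>) \<le> K * (1 + norm \<mu>) * norm (x - xb)"
proof -
  obtain K1 d1 where 1: "0 < K1" "0 < d1"
    "\<And>x. norm (x - xb) < d1 \<Longrightarrow> norm (Df x - Df xb) \<le> K1 * norm (x - xb)"
    using has_derivative_local_bound[OF Df'] by blast
  obtain K2 d2 where 2: "0 < K2" "0 < d2"
    "\<And>x. norm (x - xb) < d2 \<Longrightarrow> norm (D x - D xb) \<le> K2 * norm (x - xb)"
    using has_derivative_local_bound[OF D'] by blast
  have "norm (G x \<mu> - G xb \<mu>) \<le> (K1 + K2) * (1 + norm \<mu>) * norm (x - xb)"
    if x: "norm (x - xb) < min d1 d2" for x \<mu>
  proof -
    have "G x \<mu> - G xb \<mu> = adj (Df x - Df xb) 1 + adj (D x - D xb) \<mu>"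
      unfolding G_def bounded_bilinear.diff_left[OF bounded_bilinear_adj] by simp
    also have "norm \<dots> \<le> norm (Df x - Df xb) * norm (1 :: real) + norm (D x - D xb) * norm \<mu>"
      by (intro norm_triangle_le add_mono norm_adj_le)
    also have "\<dots> \<le> K1 * norm (x - xb) * 1 + K2 * norm (x - xb) * norm \<mu>"
      using 1(1) 2(1) 1(3)[of x] 2(3)[of x] x by (intro add_mono mult_mono) auto
    also have "\<dots> \<le> (K1 + K2) * (1 + norm \<mu>) * norm (x - xb)"
      using 1(1) 2(1) by (simp add: algebra_simps)
    finally show ?thesis .
  qed
  moreover have "0 < K1 + K2" "0 < min d1 d2" using 1 2 by simp_all
  ultimately show ?thesis by blast
qed

lemma G_tendsto:
  assumes "X \<longlonglongrightarrow> xb" "V \<longlonglongrightarrow> v"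
  shows "(\<lambda>n. G (X n) (V n)) \<longlonglongrightarrow> G xb v"
proof -
  have "(\<lambda>n. Df (X n)) \<longlonglongrightarrow> Df xb" "(\<lambda>n. D (X n)) \<longlonglongrightarrow> D xb"
    using assms(1) Df' D' has_derivative_continuous isCont_tendsto_compose by blast+
  then show ?thesis unfolding G_def
    by (intro tendsto_add bounded_bilinear.tendsto[OF bounded_bilinear_adj] assms(2) tendsto_const)
qed

text \<open>Violating multipliers may be unbounded, so they are first pulled back towards \<open>\<mu>b\<close> to
  distance \<open>e\<close>; a limit point of the resulting sequence is a second multiplier.\<close>
lemma multiplier_close:
  assumes "0 < e"
  shows "\<exists>d>0. \<forall>x y \<mu>. norm (x - xb) < d \<longrightarrow> norm (y - \<Phi> xb) < d \<longrightarrow> G x \<mu> = 0 \<longrightarrow>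
    \<mu> \<in> normal_cone soc y \<longrightarrow> norm (\<mu> - \<mu>b) < e"
proof (rule ccontr)
  assume neg: "\<not> ?thesis"
  have "\<exists>x y \<mu>. norm (x - xb) < 1 / real (Suc n) \<and> norm (y - \<Phi> xb) < 1 / real (Suc n) \<and>
      G x \<mu> = 0 \<and> \<mu> \<in> normal_cone soc y \<and> e \<le> norm (\<mu> - \<mu>b)" for n
  proof -
    have "0 < 1 / real (Suc n)" by simp
    then show ?thesis using neg by (meson not_le)
  qed
  then obtain X Y V where *: "\<And>n. norm (X n - xb) < 1 / real (Suc n)"
    "\<And>n. norm (Y n - \<Phi> xb) < 1 / real (Suc n)" "\<And>n. G (X n) (V n) = 0"
    "\<And>n. V n \<in> normal_cone soc (Y n)" "\<And>n. e \<le> norm (V n - \<mu>b)"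
    by metis
  have X: "X \<longlonglongrightarrow> xb" and Y: "Y \<longlonglongrightarrow> \<Phi> xb"
    using *(1,2) by (auto intro: tendsto_of_dist_le_inverse_Suc)
  define s where "s n = e / norm (V n - \<mu>b)" for n
  have pos: "0 < norm (V n - \<mu>b)" for n using *(5)[of n] assms by linarith
  have s: "0 \<le> s n" "s n \<le> 1" for n
    using *(5)[of n] assms pos[of n] by (simp_all add: s_def)
  define W where "W n = \<mu>b + s n *\<^sub>R (V n - \<mu>b)" for n
  have W_sphere: "W n \<in> sphere \<mu>b e" for n
    using pos[of n] assms by (simp add: W_def s_def dist_norm)
  then obtain w q where w: "w \<in> sphere \<mu>b e" "strict_mono (q :: nat \<Rightarrow> nat)" "(W \<circ> q) \<longlonglongrightarrow> w"
    using compact_sphere[of \<mu>b e] unfolding compact_def by meson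
  note Xq = LIMSEQ_subseq_LIMSEQ[OF X w(2)] and Yq = LIMSEQ_subseq_LIMSEQ[OF Y w(2)]
  have W_eq: "W n = (1 - s n) *\<^sub>R \<mu>b + s n *\<^sub>R V n" for n
    by (simp add: W_def algebra_simps)
  have "- W n \<in> soc" for n
    using soc_add[OF soc_scaleR[OF _ \<mu>b_facts(2), of "1 - s n"] soc_scaleR[of "s n" "- V n"]] s[of n] *(4)[of n]
    by (simp add: W_eq normal_cone_soc_iff)
  then have w_soc: "- w \<in> soc"
    using closed_sequentially[OF closed_soc, of "\<lambda>n. - (W \<circ> q) n"] tendsto_minus[OF w(3)] by auto
  \<comment> \<open>\<open>V n\<close> annihilates \<open>Y n\<close>, so the convex combination
    keeps only a fraction of \<open>\<mu>b \<bullet> Y n\<close>, which tends to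
    \<open>0\<close>.\<close>
  have "W n \<bullet> Y n = (1 - s n) * (\<mu>b \<bullet> Y n)" for n
    using *(4)[of n] by (simp add: W_eq normal_cone_soc_iff inner_add_left)
  then have WY: "norm (W n \<bullet> Y n) \<le> norm (\<mu>b \<bullet> Y n)" for n
    using s[of n] by (simp add: abs_mult mult_left_le_one_le)
  have "(\<lambda>n. \<mu>b \<bullet> (Y \<circ> q) n) \<longlonglongrightarrow> \<mu>b \<bullet> \<Phi> xb" by (intro tendsto_intros Yq)
  then have "(\<lambda>n. norm (\<mu>b \<bullet> (Y \<circ> q) n)) \<longlonglongrightarrow> 0" using \<mu>b_facts(3) tendsto_norm_zero by fastforce
  then have "(\<lambda>n. (W \<circ> q) n \<bullet> (Y \<circ> q) n) \<longlonglongrightarrow> 0"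
    by (rule Lim_null_comparison[rotated]) (use WY in \<open>simp add: o_def\<close>)
  moreover have "(\<lambda>n. (W \<circ> q) n \<bullet> (Y \<circ> q) n) \<longlonglongrightarrow> w \<bullet> \<Phi> xb" by (intro tendsto_intros Yq w(3))
  ultimately have "w \<bullet> \<Phi> xb = 0" using LIMSEQ_unique by blast
  then have w_normal: "w \<in> normal_cone soc (\<Phi> xb)"
    using w_soc \<mu>b_facts(1) by (simp add: normal_cone_soc_iff)
  \<comment> \<open>Likewise \<open>G (X n)\<close> is affine and vanishes at \<open>V n\<close>,
    which leaves a fraction of its value at \<open>\<mu>b\<close>.\<close>
  have GW: "norm (G (X n) (W n)) \<le> norm (G (X n) \<mu>b)" for n
  proof -
    have "G (X n) (W n) - G (X n) \<mu>b = s n *\<^sub>R (G (X n) (V n) - G (X n) \<mu>b)"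
      unfolding G_diff W_def by (simp add: bounded_bilinear.scaleR_right[OF bounded_bilinear_adj])
    then have "G (X n) (W n) = (1 - s n) *\<^sub>R G (X n) \<mu>b"
      using *(3)[of n] by (simp add: algebra_simps)
    then show ?thesis using s[of n] by (simp add: mult_left_le_one_le)
  qed
  have "(\<lambda>n. G ((X \<circ> q) n) \<mu>b) \<longlonglongrightarrow> G xb \<mu>b" by (intro G_tendsto Xq tendsto_const)
  then have "(\<lambda>n. norm (G ((X \<circ> q) n) \<mu>b)) \<longlonglongrightarrow> 0" unfolding G_xb by (rule tendsto_norm_zero)
  then have "(\<lambda>n. G ((X \<circ> q) n) ((W \<circ> q) n)) \<longlonglongrightarrow> 0"
    by (rule Lim_null_comparison[rotated]) (simp add: GW)
  moreover have "(\<lambda>n. G ((X \<circ> q) n) ((W \<circ> q) n)) \<longlonglongrightarrow> G xb w" by (intro G_tendsto Xq w(3))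
  ultimately have "G xb w = 0" using LIMSEQ_unique by blast
  then have "w = \<mu>b" using w_normal multiplier_iff by blast
  then show False using w(1) assms by simp
qed

text \<open>As the unperturbed multiplier set is \<open>{\<mu>b}\<close>, the inclusion defining
  calmness becomes a norm estimate.\<close>

lemma calmness_bound:
  "\<exists>l\<ge>0. \<exists>e>0. \<forall>v w \<mu>. norm (v, w) < e \<longrightarrow> norm (\<mu> - \<mu>b) < e \<longrightarrow> G xb \<mu> = v \<longrightarrow>
     \<mu> \<in> normal_cone soc (\<Phi> xb + w) \<longrightarrow> norm (\<mu> - \<mu>b) \<le> l * norm (v, w)"
proof -
  have map: "multiplier_map f \<Phi> xb (v, w) = {\<mu>. G xb \<mu> = v \<and> \<mu> \<in> normal_cone soc (\<Phi> xb + w)}" for v w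
    by (simp add: multiplier_map_def grad_lagrangian[OF xb_in])
  have map0: "multiplier_map f \<Phi> xb (0, 0) = {\<mu>b}"
    unfolding map add_0_right multiplier_iff by simp
  obtain l U V where l: "0 \<le> l" and U: "open U" "(0, 0) \<in> U" and V: "open V" "\<mu>b \<in> V"
    and sub: "\<forall>p\<in>U. multiplier_map f \<Phi> xb p \<inter> V \<subseteq>
      {y + (l * norm (p - (0, 0))) *\<^sub>R b | y b. y \<in> multiplier_map f \<Phi> xb (0, 0) \<and> b \<in> cball 0 1}"
    using calm unfolding calm_at_def by (elim conjE exE) (rule that)
  obtain e1 where e1: "0 < e1" "ball (0, 0) e1 \<subseteq> U" using U open_contains_ball by blast
  obtain e2 where e2: "0 < e2" "ball \<mu>b e2 \<subseteq> V" using V open_contains_ball by blast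
  have "norm (\<mu> - \<mu>b) \<le> l * norm (v, w)"
    if "norm (v, w) < min e1 e2" "norm (\<mu> - \<mu>b) < min e1 e2" "G xb \<mu> = v"
      "\<mu> \<in> normal_cone soc (\<Phi> xb + w)" for v w \<mu>
  proof -
    have "(v, w) \<in> ball (0, 0) e1" using that(1) by (simp add: dist_norm norm_Pair)
    then have "(v, w) \<in> U" using e1(2) by blast
    moreover have "\<mu> \<in> ball \<mu>b e2" using that(2) by (simp add: dist_norm norm_minus_commute)
    then have "\<mu> \<in> V" using e2(2) by blast
    moreover have "\<mu> \<in> multiplier_map f \<Phi> xb (v, w)" unfolding map using that by simp
    ultimately have "\<mu> \<in> {y + (l * norm ((v, w) - (0, 0))) *\<^sub>R b | y b. y \<in> {\<mu>b} \<and> b \<in> cball 0 1}"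
      using bspec[OF sub, of "(v, w)"] unfolding map0 by blast
    then obtain b where b: "\<mu> = \<mu>b + (l * norm ((v, w) - (0, 0))) *\<^sub>R b" "norm b \<le> 1"
      unfolding mem_Collect_eq mem_cball_0 singleton_iff by blast
    have "(v, w) - (0, 0) = (v, w)" by simp
    note b = b[unfolded this]
    then show ?thesis using l by (simp add: mult_left_le)
  qed
  then show ?thesis using l e1(1) e2(1) by (intro exI[of _ l] conjI exI[of _ "min e1 e2"]) auto
qed

text \<open>Freezing \<open>x\<close> at \<open>xb\<close> makes \<open>\<mu>\<close> a value of the
  multiplier map at the perturbation \<open>(G xb \<mu>, y - \<Phi> xb)\<close>, whose first part is
  of order \<open>norm (x - xb)\<close>. \<open>multiplier_close\<close> brings \<open>\<mu>\<close>
  into the neighbourhood where calmness applies.\<close>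

lemma multiplier_calm:
  "\<exists>C>0. \<exists>d>0. \<forall>x y \<mu>. norm (x - xb) < d \<longrightarrow> norm (y - \<Phi> xb) < d \<longrightarrow> G x \<mu> = 0 \<longrightarrow>
    \<mu> \<in> normal_cone soc y \<longrightarrow> norm (\<mu> - \<mu>b) \<le> C * (norm (x - xb) + norm (y - \<Phi> xb))"
proof -
  obtain l e where l: "0 \<le> l" "0 < e" and bound: "\<And>v w \<mu>. norm (v, w) < e \<Longrightarrow> norm (\<mu> - \<mu>b) < e \<Longrightarrow>
      G xb \<mu> = v \<Longrightarrow> \<mu> \<in> normal_cone soc (\<Phi> xb + w) \<Longrightarrow> norm (\<mu> - \<mu>b) \<le> l * norm (v, w)"
    using calmness_bound by metis
  obtain d1 where d1: "0 < d1" "\<And>x y \<mu>. norm (x - xb) < d1 \<Longrightarrow> norm (y - \<Phi> xb) < d1 \<Longrightarrow> G x \<mu> = 0 \<Longrightarrow>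
      \<mu> \<in> normal_cone soc y \<Longrightarrow> norm (\<mu> - \<mu>b) < min e 1"
    using multiplier_close[of "min e 1"] l(2) by auto
  obtain K d2 where K: "0 < K" "0 < d2" "\<And>x \<mu>. norm (x - xb) < d2 \<Longrightarrow>
      norm (G x \<mu> - G xb \<mu>) \<le> K * (1 + norm \<mu>) * norm (x - xb)"
    using G_local_lipschitz by metis
  \<comment> \<open>Since \<open>\<mu>\<close> will be within distance \<open>1\<close> of
    \<open>\<mu>b\<close>, this covers \<open>K * (1 + norm \<mu>)\<close>; the summand
    \<open>1\<close> lets it also serve as coefficient of
    \<open>norm (y - \<Phi> xb)\<close>.\<close>
  define K' where "K' = K * (2 + norm \<mu>b) + 1"
  have K': "1 \<le> K'" using K(1) by (simp add: K'_def)
  \<comment> \<open>The divisor \<open>4 * K'\<close> keeps the perturbation, which is at most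
    \<open>K' * (d + d)\<close>, below \<open>e\<close>.\<close>
  define d where "d = min (min d1 d2) (e / (4 * K'))"
  have d: "0 < d" "d \<le> d1" "d \<le> d2" "d \<le> e / (4 * K')"
    using d1(1) K(2) l(2) K' by (simp_all add: d_def)
  have K'd: "K' * d \<le> e / 4"
    using mult_left_mono[OF d(4), of K'] K' by simp
  \<comment> \<open>The summand \<open>1\<close> keeps the constant positive when
    \<open>l = 0\<close>.\<close>
  have "norm (\<mu> - \<mu>b) \<le> (l * K' + 1) * (norm (x - xb) + norm (y - \<Phi> xb))"
    if x: "norm (x - xb) < d" and y: "norm (y - \<Phi> xb) < d" and G: "G x \<mu> = 0"
      and n: "\<mu> \<in> normal_cone soc y" for x y \<mu>
  proof -
    have \<mu>: "norm (\<mu> - \<mu>b) < min e 1" using d1(2)[OF _ _ G n] x y d by auto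
    then have "norm \<mu> \<le> norm \<mu>b + 1" using norm_triangle_ineq[of "\<mu> - \<mu>b" \<mu>b] by simp
    then have "K * (1 + norm \<mu>) \<le> K * (2 + norm \<mu>b)" using K(1) by (intro mult_left_mono) auto
    then have "K * (1 + norm \<mu>) \<le> K'" by (simp add: K'_def)
    then have v: "norm (G xb \<mu>) \<le> K' * norm (x - xb)"
      using K(3)[of x \<mu>] x d(3) G mult_right_mono[of "K * (1 + norm \<mu>)" K' "norm (x - xb)"] by simp
    define p where "p = norm (G xb \<mu>, y - \<Phi> xb)"
    have "p \<le> norm (G xb \<mu>) + norm (y - \<Phi> xb)"
      unfolding p_def by (rule norm_Pair_le)
    also have "\<dots> \<le> K' * norm (x - xb) + K' * norm (y - \<Phi> xb)"
      using v mult_right_mono[OF K', of "norm (y - \<Phi> xb)"] by simp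
    finally have p: "p \<le> K' * (norm (x - xb) + norm (y - \<Phi> xb))" by (simp add: distrib_left)
    also have "\<dots> \<le> K' * (d + d)" using x y K' by (intro mult_left_mono) auto
    also have "\<dots> < e" using K'd l(2) by (simp add: distrib_left)
    finally have "norm (\<mu> - \<mu>b) \<le> l * p"
      unfolding p_def using \<mu> n by (intro bound) auto
    also have "\<dots> \<le> l * (K' * (norm (x - xb) + norm (y - \<Phi> xb)))" by (intro mult_left_mono p l)
    also have "\<dots> \<le> (l * K' + 1) * (norm (x - xb) + norm (y - \<Phi> xb))" by (simp add: algebra_simps)
    finally show ?thesis .
  qed
  moreover have "0 < l * K' + 1" using l K' by (simp add: add_nonneg_pos)
  ultimately show ?thesis using d(1) by blast
qed

text \<open>If it fails, \<open>multiplier_calm\<close> eliminates the multiplier from the violated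
  inequality, so the perturbation is negligible against \<open>norm (x - xb)\<close> and the scaled
  multiplier errors stay bounded. Limits \<open>\<xi>\<close> and \<open>\<eta>\<close> solve the
  linearised stationarity equation; pairing it with \<open>\<xi>\<close> contradicts SOSC by
  \<open>normal_cone_soc_graph_limit\<close>.\<close>

lemma KKT_error_bound:
  "\<exists>\<kappa>>0. \<exists>d>0. \<forall>x y \<mu>. norm (x - xb) < d \<longrightarrow> norm (y - \<Phi> xb) < d \<longrightarrow> G x \<mu> = 0 \<longrightarrow>
    \<mu> \<in> normal_cone soc y \<longrightarrow> norm (x - xb) + norm (\<mu> - \<mu>b) \<le> \<kappa> * norm (y - \<Phi> x)"
proof (rule ccontr)
  assume neg: "\<not> ?thesis"
  obtain C d1 where C: "0 < C" "0 < d1" "\<And>x y \<mu>. norm (x - xb) < d1 \<Longrightarrow> norm (y - \<Phi> xb) < d1 \<Longrightarrow>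
      G x \<mu> = 0 \<Longrightarrow> \<mu> \<in> normal_cone soc y \<Longrightarrow> norm (\<mu> - \<mu>b) \<le> C * (norm (x - xb) + norm (y - \<Phi> xb))"
    using multiplier_calm by metis
  obtain K d2 where K: "0 < K" "0 < d2"
    "\<And>x. norm (x - xb) < d2 \<Longrightarrow> norm (\<Phi> x - \<Phi> xb) \<le> K * norm (x - xb)"
    using has_derivative_local_bound[OF D[OF xb_in]] by blast
  define d0 where "d0 = min d1 d2"
  have d0: "0 < d0" "d0 \<le> d1" "d0 \<le> d2" using C K by (auto simp: d0_def)
  \<comment> \<open>\<open>A\<close> collects the coefficients of \<open>norm (x - xb)\<close> once
    the multiplier error is estimated. With the factor \<open>C + A * real (Suc n)\<close> below,
    the \<open>C\<close> terms then cancel and \<open>A\<close> divides out, leaving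
    \<open>W\<close>.\<close>
  define A where "A = 1 + C + C * K"
  have A: "1 \<le> A" using C(1) K(1) by (simp add: A_def)
  have "\<exists>x y \<mu>. norm (x - xb) < min d0 (1 / real (Suc n)) \<and>
      norm (y - \<Phi> xb) < min d0 (1 / real (Suc n)) \<and> G x \<mu> = 0 \<and> \<mu> \<in> normal_cone soc y \<and>
      (C + A * real (Suc n)) * norm (y - \<Phi> x) < norm (x - xb) + norm (\<mu> - \<mu>b)" for n
  proof -
    have "0 < A * real (Suc n)" using A by (intro mult_pos_pos) simp_all
    then have "0 < min d0 (1 / real (Suc n))" "0 < C + A * real (Suc n)"
      using d0 C(1) by simp_all
    then show ?thesis using neg by (meson not_le)
  qed
  then obtain X0 Y0 V0 where *: "\<And>n. norm (X0 n - xb) < min d0 (1 / real (Suc n))"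
    "\<And>n. norm (Y0 n - \<Phi> xb) < min d0 (1 / real (Suc n))" "\<And>n. G (X0 n) (V0 n) = 0"
    "\<And>n. V0 n \<in> normal_cone soc (Y0 n)"
    "\<And>n. (C + A * real (Suc n)) * norm (Y0 n - \<Phi> (X0 n)) < norm (X0 n - xb) + norm (V0 n - \<mu>b)"
    by metis
  have YX: "norm (Y0 n - \<Phi> xb) \<le> norm (Y0 n - \<Phi> (X0 n)) + K * norm (X0 n - xb)" for n
  proof -
    have "norm (\<Phi> (X0 n) - \<Phi> xb) \<le> K * norm (X0 n - xb)" using K(3)[of "X0 n"] *(1)[of n] d0 by simp
    then show ?thesis using norm_triangle_ineq[of "Y0 n - \<Phi> (X0 n)" "\<Phi> (X0 n) - \<Phi> xb"] by simp
  qed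
  have V: "norm (V0 n - \<mu>b) \<le> C * (norm (X0 n - xb) + norm (Y0 n - \<Phi> xb))" for n
    using *(1,2)[of n] d0 by (intro C(3)[OF _ _ *(3,4)]) auto
  have W: "real (Suc n) * norm (Y0 n - \<Phi> (X0 n)) < norm (X0 n - xb)" for n
  proof -
    have "C * norm (Y0 n - \<Phi> xb) \<le> C * (norm (Y0 n - \<Phi> (X0 n)) + K * norm (X0 n - xb))"
      using YX C(1) by (intro mult_left_mono) auto
    then have "(C + A * real (Suc n)) * norm (Y0 n - \<Phi> (X0 n))
        < A * norm (X0 n - xb) + C * norm (Y0 n - \<Phi> (X0 n))"
      using *(5)[of n] V[of n] by (simp add: A_def algebra_simps)
    then have "A * (real (Suc n) * norm (Y0 n - \<Phi> (X0 n))) < A * norm (X0 n - xb)"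
      by (simp only: distrib_right mult.assoc)
    then show ?thesis using A by (simp only: mult_less_cancel_left_pos)
  qed
  have X0_ne: "X0 n \<noteq> xb" for n
  proof
    assume "X0 n = xb"
    then have "real (Suc n) * norm (Y0 n - \<Phi> (X0 n)) < 0" using W[of n] by simp
    moreover have "0 \<le> real (Suc n) * norm (Y0 n - \<Phi> (X0 n))" by simp
    ultimately show False by linarith
  qed
  have X0_lim: "X0 \<longlonglongrightarrow> xb" using *(1) by (auto intro: tendsto_of_dist_le_inverse_Suc)
  obtain q1 \<xi> where q1: "strict_mono q1" "norm \<xi> = 1"
    "(\<lambda>n. inverse (norm (X0 (q1 n) - xb)) *\<^sub>R (X0 (q1 n) - xb)) \<longlonglongrightarrow> \<xi>"
    using unit_direction_subsequence[of X0 xb, OF X0_ne] by blast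
  \<comment> \<open>Multiplier errors are scaled by the distance of \<open>x\<close> to
    \<open>xb\<close>; \<open>V\<close>, \<open>YX\<close> and \<open>W\<close> bound these
    quotients, so a further subsequence converges.\<close>
  define E0 where "E0 n = inverse (norm (X0 n - xb)) *\<^sub>R (V0 n - \<mu>b)" for n
  have "norm (E0 n) \<le> C * (2 + K)" for n
  proof -
    have "norm (Y0 n - \<Phi> (X0 n)) \<le> real (Suc n) * norm (Y0 n - \<Phi> (X0 n))"
      using mult_right_mono[of 1 "real (Suc n)" "norm (Y0 n - \<Phi> (X0 n))"] by simp
    then have "norm (X0 n - xb) + norm (Y0 n - \<Phi> xb) \<le> (2 + K) * norm (X0 n - xb)"
      using YX[of n] W[of n] by (simp only: distrib_right)
    then have "norm (V0 n - \<mu>b) \<le> C * ((2 + K) * norm (X0 n - xb))"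
      using V[of n] mult_left_mono[of _ _ C] C(1) by (meson less_imp_le order_trans)
    then have "norm (V0 n - \<mu>b) \<le> C * (2 + K) * norm (X0 n - xb)"
      by (simp only: mult.assoc)
    then have "norm (V0 n - \<mu>b) / norm (X0 n - xb) \<le> C * (2 + K)"
      using X0_ne[of n] by (subst pos_divide_le_eq) simp_all
    then show ?thesis by (simp add: E0_def divide_inverse_commute)
  qed
  then have "\<forall>n. (E0 \<circ> q1) n \<in> cball 0 (C * (2 + K))" by simp
  then obtain \<eta> q2 where q2: "strict_mono (q2 :: nat \<Rightarrow> nat)" "((E0 \<circ> q1) \<circ> q2) \<longlonglongrightarrow> \<eta>"
    using compact_cball[of 0 "C * (2 + K)"] unfolding compact_def by meson
  define q where "q = q1 \<circ> q2"
  have q: "strict_mono q" unfolding q_def using q1(1) q2(1) by (rule strict_mono_o)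
  define X t where "X = X0 \<circ> q" and "t = (\<lambda>n. norm (X n - xb))"
  interpret directional_sequence X xb \<xi> t
    using X0_ne LIMSEQ_subseq_LIMSEQ[OF X0_lim q] LIMSEQ_subseq_LIMSEQ[OF q1(3) q2(1)]
    by unfold_locales (auto simp: X_def t_def q_def o_def)
  define Y V where "Y = Y0 \<circ> q" and "V = V0 \<circ> q"
  define E U where "E n = inverse (t n) *\<^sub>R (V n - \<mu>b)" and "U n = inverse (t n) *\<^sub>R (Y n - \<Phi> xb)" for n
  have E: "E \<longlonglongrightarrow> \<eta>"
    using q2(2) by (simp add: E_def[abs_def] E0_def o_def q_def V_def t_def X_def)
  have VE: "\<mu>b + t n *\<^sub>R E n = V n" and YU: "\<Phi> xb + t n *\<^sub>R U n = Y n" for n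
    using t_pos[of n] by (simp_all add: E_def U_def)
  have "(\<lambda>n. inverse (t n) *\<^sub>R (Y n - \<Phi> (X n))) \<longlonglongrightarrow> 0"
  proof (rule Lim_null_comparison)
    show "\<forall>\<^sub>F n in sequentially. norm (inverse (t n) *\<^sub>R (Y n - \<Phi> (X n))) \<le> 1 / real (Suc (q n))"
    proof (intro always_eventually allI)
      fix n
      have "norm (Y n - \<Phi> (X n)) * real (Suc (q n)) \<le> t n"
        using W[of "q n"] by (simp add: Y_def X_def t_def mult.commute del: of_nat_Suc)
      then have "norm (Y n - \<Phi> (X n)) / t n \<le> 1 / real (Suc (q n))"
        using t_pos[of n] by (simp add: field_simps del: of_nat_Suc)
      then show "norm (inverse (t n) *\<^sub>R (Y n - \<Phi> (X n))) \<le> 1 / real (Suc (q n))"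
        using t_pos[of n] by (simp add: divide_inverse_commute del: of_nat_Suc)
    qed
    show "(\<lambda>n. 1 / real (Suc (q n))) \<longlonglongrightarrow> 0"
      using LIMSEQ_subseq_LIMSEQ[OF LIMSEQ_inverse_real_of_nat q] by (simp add: inverse_eq_divide o_def)
  qed
  from tendsto_add[OF this derivative_quotient[OF D[OF xb_in]]]
  have U: "U \<longlonglongrightarrow> blinfun_apply (D xb) \<xi>"
    by (simp add: U_def[abs_def] flip: scaleR_add_right)
  have graph: "\<mu>b + t n *\<^sub>R E n \<in> normal_cone soc (\<Phi> xb + t n *\<^sub>R U n)" for n
    unfolding VE YU using *(4) by (simp add: V_def Y_def)
  have feas: "\<Phi> xb + t n *\<^sub>R U n \<in> soc" for n
    using graph[of n] by (simp add: normal_cone_soc_iff)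
  note lim = normal_cone_soc_graph_limit[OF t_pos t_lim U E \<mu>b_normal graph]
  have "(\<lambda>n. inverse (t n) *\<^sub>R (G (X n) \<mu>b - G xb \<mu>b)) \<longlonglongrightarrow> H \<xi>"
    by (rule derivative_quotient[OF G_derivative])
  moreover have "(\<lambda>n. adj (D (X n)) (E n)) \<longlonglongrightarrow> adj (D xb) \<eta>"
    using isCont_tendsto_compose[OF has_derivative_continuous[OF D'] X_lim] E
    by (intro bounded_bilinear.tendsto[OF bounded_bilinear_adj])
  ultimately have "(\<lambda>n. inverse (t n) *\<^sub>R (G (X n) \<mu>b - G xb \<mu>b) + adj (D (X n)) (E n))
      \<longlonglongrightarrow> H \<xi> + adj (D xb) \<eta>"
    by (rule tendsto_add)
  \<comment> \<open>This is \<open>G (X n) (V n) = 0\<close> divided by \<open>t n\<close>, split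
    into the increment in \<open>x\<close> at \<open>\<mu>b\<close> and the increment in the
    multiplier.\<close>
  moreover have "inverse (t n) *\<^sub>R (G (X n) \<mu>b - G xb \<mu>b) + adj (D (X n)) (E n) = 0" for n
  proof -
    have "adj (D (X n)) (E n) = inverse (t n) *\<^sub>R (G (X n) (V n) - G (X n) \<mu>b)"
      unfolding G_diff E_def by (rule bounded_bilinear.scaleR_right[OF bounded_bilinear_adj])
    moreover have "G (X n) (V n) = 0" using *(3) by (simp add: X_def V_def)
    ultimately show ?thesis by (simp add: G_xb)
  qed
  ultimately have "H \<xi> + adj (D xb) \<eta> = 0" using LIMSEQ_unique[OF tendsto_const] by fastforce
  then have "(H \<xi> + adj (D xb) \<eta>) \<bullet> \<xi> = 0" by simp
  then have "H \<xi> \<bullet> \<xi> + \<eta> \<bullet> blinfun_apply (D xb) \<xi> = 0"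
    by (metis inner_add_left inner_commute inner_adj)
  moreover have "\<xi> \<noteq> 0" using q1(2) by auto
  ultimately show False
    using SOSC_contradiction[OF _ t_pos t_lim U feas lim(1) lim(2)] by simp
qed

section \<open>Solving the subproblem and local convergence\<close>

text \<open>The next iterate is a minimiser over a small closed ball: growth forces it into the interior,
  where stationarity makes it a solution of the KKT system with \<open>\<Phi>\<close> perturbed by \<open>(\<mu> - \<mu>') / \<rho>\<close>,
  so that the error bound gives a contraction for large \<open>\<rho>\<close>.\<close>
lemma alm_step:
  "\<exists>\<gamma>>0. \<exists>\<rho>b>0. \<forall>\<mu> \<rho>. norm (\<mu> - \<mu>b) \<le> \<gamma> \<longrightarrow> \<rho>b \<le> \<rho> \<longrightarrow> (\<exists>x. x \<in> ball xb r \<and>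
     GDERIV (\<lambda>x. aug_lagrangian f \<Phi> x \<mu> \<rho>) x :> 0 \<and>
     norm (x - xb) + norm (closest_point (uminus ` soc) (\<rho> *\<^sub>R \<Phi> x + \<mu>) - \<mu>b) \<le> norm (\<mu> - \<mu>b) / 2)"
proof -
  obtain \<rho>0 c d1 where gr: "0 < \<rho>0" "0 < c" "0 < d1" "\<And>x. norm (x - xb) \<le> d1 \<Longrightarrow>
      f xb + c * (norm (x - xb))\<^sup>2 \<le> aug_lagrangian f \<Phi> x \<mu>b \<rho>0"
    using aug_lagrangian_growth by metis
  obtain \<kappa> d2 where eb: "0 < \<kappa>" "0 < d2" "\<And>x y \<mu>. norm (x - xb) < d2 \<Longrightarrow> norm (y - \<Phi> xb) < d2 \<Longrightarrow>
      G x \<mu> = 0 \<Longrightarrow> \<mu> \<in> normal_cone soc y \<Longrightarrow> norm (x - xb) + norm (\<mu> - \<mu>b) \<le> \<kappa> * norm (y - \<Phi> x)"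
    using KKT_error_bound by metis
  obtain d3 where d3: "0 < d3" "\<And>x. dist x xb < d3 \<Longrightarrow> dist (\<Phi> x) (\<Phi> xb) < d2 / 2"
    using \<Phi>_continuous eb(2) unfolding continuous_at_eps_delta by (metis half_gt_zero)
  define \<delta> where "\<delta> = min (min d1 d2) (min d3 r) / 2"
  have \<delta>: "0 < \<delta>" "\<delta> \<le> d1" "\<delta> < d2" "\<delta> < d3" "\<delta> < r"
    using gr(3) eb(2) d3(1) r by (auto simp: \<delta>_def)
  \<comment> \<open>The first bound keeps \<open>y\<close> within \<open>d2\<close> of
    \<open>\<Phi> xb\<close>. The second makes the perturbation error at most
    \<open>c * \<delta>\<^sup>2 / 2\<close>, less than the growth on the sphere of radius
    \<open>\<delta>\<close>.\<close>
  define \<gamma> where "\<gamma> = min (d2 / 4) (\<delta> * sqrt c)"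
  have \<gamma>: "0 < \<gamma>" "\<gamma> \<le> d2 / 4" "\<gamma> \<le> \<delta> * sqrt c"
    using eb(2) \<delta>(1) gr(2) by (simp_all add: \<gamma>_def)
  \<comment> \<open>\<open>\<rho>0 + 1\<close> is what \<open>aug_lagrangian_perturb\<close>
    requires; \<open>3 * \<kappa>\<close> turns the error bound into a factor
    \<open>1/3\<close>.\<close>
  define \<rho>b where "\<rho>b = max (\<rho>0 + 1) (3 * \<kappa>)"
  have step: "\<exists>x. x \<in> ball xb r \<and> GDERIV (\<lambda>x. aug_lagrangian f \<Phi> x \<mu> \<rho>) x :> 0 \<and>
     norm (x - xb) + norm (closest_point (uminus ` soc) (\<rho> *\<^sub>R \<Phi> x + \<mu>) - \<mu>b) \<le> norm (\<mu> - \<mu>b) / 2"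
    if \<mu>: "norm (\<mu> - \<mu>b) \<le> \<gamma>" and \<rho>b: "\<rho>b \<le> \<rho>" for \<mu> \<rho>
  proof -
    let ?L = "\<lambda>x. aug_lagrangian f \<Phi> x \<mu> \<rho>"
    have \<rho>: "\<rho>0 + 1 \<le> \<rho>" "3 * \<kappa> \<le> \<rho>" "1 \<le> \<rho>" "0 < \<rho>"
      using \<rho>b gr(1) by (simp_all add: \<rho>b_def)
    have in_ball: "x \<in> ball xb r" if "x \<in> cball xb \<delta>" for x using that \<delta>(5) by simp
    have GD: "GDERIV ?L x :> G x (\<rho> *\<^sub>R (\<Phi> x + inverse \<rho> *\<^sub>R \<mu> - soc_proj (\<Phi> x + inverse \<rho> *\<^sub>R \<mu>)))"
      if "x \<in> cball xb \<delta>" for x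
      unfolding G_def by (intro GDERIV_aug_lagrangian \<rho>(4) GDERIV_f D in_ball that refl)
    have "continuous_on (cball xb \<delta>) ?L"
      using GD unfolding gderiv_def
      by (intro continuous_at_imp_continuous_on ballI) (blast dest: has_derivative_continuous)
    then obtain x where x: "x \<in> cball xb \<delta>" "\<And>x'. x' \<in> cball xb \<delta> \<Longrightarrow> ?L x \<le> ?L x'"
      using continuous_attains_inf[of "cball xb \<delta>" ?L] \<delta>(1) by auto
    have nx: "norm (x - xb) \<le> \<delta>" using x(1) by (simp add: dist_norm norm_minus_commute)
    \<comment> \<open>Feasibility of \<open>xb\<close> bounds the minimum from above and growth
      bounds it from below; together they keep the minimiser off the sphere.\<close>
    have "?L x \<le> f xb"
      using x(2)[of xb] \<delta>(1) aug_lagrangian_feasible_le[of \<rho> \<Phi> xb f \<mu>] \<rho>(4) \<mu>b_facts(1) by simp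
    moreover have "f xb + c * (norm (x - xb))\<^sup>2 - (norm (\<mu> - \<mu>b))\<^sup>2 / 2 \<le> ?L x"
      using aug_lagrangian_perturb[OF gr(1) \<rho>(1), of f \<Phi> x \<mu>b \<mu>] gr(4)[of x] nx \<delta>(2) by linarith
    moreover have "(norm (\<mu> - \<mu>b))\<^sup>2 \<le> c * \<delta>\<^sup>2"
      using power_mono[of "norm (\<mu> - \<mu>b)" "\<delta> * sqrt c" 2] \<mu> \<gamma>(3) gr(2)
      by (simp add: power_mult_distrib mult.commute)
    moreover have "0 < c * \<delta>\<^sup>2" using gr(2) \<delta>(1) by simp
    ultimately have "c * (norm (x - xb))\<^sup>2 < c * \<delta>\<^sup>2" by linarith
    then have "(norm (x - xb))\<^sup>2 < \<delta>\<^sup>2" using gr(2) by simp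
    then have nx': "norm (x - xb) < \<delta>" using \<delta>(1) by (intro power2_less_imp_less[of _ \<delta>]) auto
    define z where "z = \<Phi> x + inverse \<rho> *\<^sub>R \<mu>"
    define y where "y = soc_proj z"
    define \<nu> where "\<nu> = \<rho> *\<^sub>R (z - y)"
    have GDx: "GDERIV ?L x :> G x \<nu>" using GD[OF x(1)] by (simp add: \<nu>_def y_def z_def)
    have "(\<lambda>h. h \<bullet> G x \<nu>) = (\<lambda>h. 0)"
    proof (rule differential_zero_maxmin[of x "ball xb \<delta>" ?L])
      show "x \<in> ball xb \<delta>" using nx' by (simp add: dist_norm norm_minus_commute)
      show "(?L has_derivative (\<lambda>h. h \<bullet> G x \<nu>)) (at x)" using GDx by (simp add: gderiv_def)
    qed (use x(2) in auto)
    then have G0: "G x \<nu> = 0" by (metis inner_eq_zero_iff)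
    have cp: "closest_point (uminus ` soc) (\<rho> *\<^sub>R \<Phi> x + \<mu>) = \<nu>"
      using closest_point_uminus_soc[of \<rho> z] \<rho>(4) by (simp add: \<nu>_def y_def z_def scaleR_add_right)
    have n: "\<nu> \<in> normal_cone soc y"
      unfolding \<nu>_def y_def using \<rho>(4) by (intro normal_cone_soc_scaleR soc_proj_normal) simp
    \<comment> \<open>Shifting \<open>\<Phi> xb\<close> by a normal vector does not change its
      projection, so nonexpansiveness places \<open>y\<close> near \<open>\<Phi> xb\<close>, as the
      error bound demands.\<close>
    have "soc_proj (\<Phi> xb + inverse \<rho> *\<^sub>R \<mu>b) = \<Phi> xb"
      using \<rho>(4) by (intro soc_proj_eqI normal_cone_soc_scaleR \<mu>b_normal) simp
    then have "norm (y - \<Phi> xb) \<le> norm (z - (\<Phi> xb + inverse \<rho> *\<^sub>R \<mu>b))"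
      using closest_point_lipschitz[OF convex_soc closed_soc soc_nonempty, of z "\<Phi> xb + inverse \<rho> *\<^sub>R \<mu>b"]
      by (simp add: y_def dist_norm)
    also have "z - (\<Phi> xb + inverse \<rho> *\<^sub>R \<mu>b) = (\<Phi> x - \<Phi> xb) + inverse \<rho> *\<^sub>R (\<mu> - \<mu>b)"
      by (simp add: z_def algebra_simps)
    also have "norm \<dots> \<le> norm (\<Phi> x - \<Phi> xb) + inverse \<rho> * norm (\<mu> - \<mu>b)"
      using norm_triangle_ineq[of "\<Phi> x - \<Phi> xb" "inverse \<rho> *\<^sub>R (\<mu> - \<mu>b)"] \<rho>(4) by simp
    also have "\<dots> < d2 / 2 + 1 * \<gamma>"
      using d3(2)[of x] nx \<delta>(4) \<mu> \<rho>(3,4)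
      by (intro add_less_le_mono mult_mono) (auto simp: dist_norm inverse_le_1_iff)
    also have "\<dots> < d2" using \<gamma>(2) eb(2) by simp
    finally have "norm (x - xb) + norm (\<nu> - \<mu>b) \<le> \<kappa> * norm (y - \<Phi> x)"
      using nx \<delta>(3) by (intro eb(3)[OF _ _ G0 n]) auto
    also have "\<kappa> * norm (y - \<Phi> x) \<le> \<rho> / 3 * norm (y - \<Phi> x)"
      using \<rho>(2) by (intro mult_right_mono) auto
    also have "\<dots> = norm (\<rho> *\<^sub>R (y - \<Phi> x)) / 3" using \<rho>(4) by simp
    also have "\<rho> *\<^sub>R (y - \<Phi> x) = \<mu> - \<nu>"
      using \<rho>(4) by (simp add: \<nu>_def z_def algebra_simps)
    finally have "norm (x - xb) + norm (\<nu> - \<mu>b) \<le> norm (\<mu> - \<nu>) / 3" .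
    moreover have "norm (\<mu> - \<nu>) \<le> norm (\<mu> - \<mu>b) + norm (\<nu> - \<mu>b)"
      using norm_triangle_ineq4[of "\<mu> - \<mu>b" "\<nu> - \<mu>b"] by simp
    \<comment> \<open>Absorbing a third of the new error leaves two thirds of it against a third of
      the old multiplier error.\<close>
    ultimately have "norm (x - xb) + norm (\<nu> - \<mu>b) \<le> norm (\<mu> - \<mu>b) / 2"
      using norm_ge_zero[of "x - xb"] by linarith
    then show ?thesis using in_ball[OF x(1)] GDx G0 cp by auto
  qed
  have "0 < \<rho>b" using gr(1) by (simp add: \<rho>b_def)
  then show ?thesis using step \<gamma>(1) by blast
qed

text \<open>Exact stationary points meet every tolerance, since \<open>\<omega>\<close> is
  nonnegative on residuals. The step map \<open>S\<close> takes the multiplier and the penalty, so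
  the method becomes a recursion on multipliers, and each step at least halves the combined
  error.\<close>

lemma alm_convergence:
  "\<exists>\<gamma>b>0. \<exists>\<rho>b>0. \<forall>(x0, \<mu>0) \<in> cball (xb, \<mu>b) \<gamma>b.
    \<forall>\<rho> :: nat \<Rightarrow> real. (\<forall>k. \<rho> k \<ge> \<rho>b) \<longrightarrow> (\<forall>\<omega>. tolerance_rule \<omega> \<longrightarrow>
      (\<exists>x \<mu>. x 0 = x0 \<and> \<mu> 0 = \<mu>0 \<and> ALM_sequence f \<Phi> \<rho> \<omega> x \<mu> \<and>
        (\<lambda>k. (x k, \<mu> k)) \<longlonglongrightarrow> (xb, \<mu>b) \<and> linear_rate x \<mu> xb \<mu>b))"
proof -
  obtain \<gamma> \<rho>b S where \<gamma>: "0 < \<gamma>" and \<rho>b: "0 < \<rho>b"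
    and S: "\<And>\<mu> \<rho>. norm (\<mu> - \<mu>b) \<le> \<gamma> \<Longrightarrow> \<rho>b \<le> \<rho> \<Longrightarrow> S \<mu> \<rho> \<in> ball xb r \<and>
     GDERIV (\<lambda>x. aug_lagrangian f \<Phi> x \<mu> \<rho>) (S \<mu> \<rho>) :> 0 \<and>
     norm (S \<mu> \<rho> - xb) + norm (closest_point (uminus ` soc) (\<rho> *\<^sub>R \<Phi> (S \<mu> \<rho>) + \<mu>) - \<mu>b)
       \<le> norm (\<mu> - \<mu>b) / 2"
    using alm_step by metis
  \<comment> \<open>The radius \<open>r / 2\<close> puts \<open>x0\<close> where the Lagrangian is
    differentiable; \<open>\<gamma>\<close> admits \<open>\<mu>0\<close> to the step map.\<close>
  have main: "\<exists>x \<mu>. x 0 = x0 \<and> \<mu> 0 = \<mu>0 \<and> ALM_sequence f \<Phi> \<rho> \<omega> x \<mu> \<and>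
        (\<lambda>k. (x k, \<mu> k)) \<longlonglongrightarrow> (xb, \<mu>b) \<and> linear_rate x \<mu> xb \<mu>b"
    if start: "(x0, \<mu>0) \<in> cball (xb, \<mu>b) (min \<gamma> (r / 2))" and \<rho>: "\<And>k. \<rho>b \<le> \<rho> k"
      and \<omega>: "tolerance_rule \<omega>" for x0 \<mu>0 \<rho> \<omega>
  proof -
    have start': "norm (x0 - xb, \<mu>0 - \<mu>b) \<le> min \<gamma> (r / 2)"
      using start by (simp add: dist_norm norm_Pair norm_minus_commute)
    have x0: "norm (x0 - xb) < r"
      using norm_fst_le[of "x0 - xb" "\<mu>0 - \<mu>b"] start' r by simp
    have \<mu>0: "norm (\<mu>0 - \<mu>b) \<le> \<gamma>"
      using norm_snd_le[of "\<mu>0 - \<mu>b" "x0 - xb"] start' by simp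
    define \<mu> where "\<mu> = rec_nat \<mu>0 (\<lambda>k m. closest_point (uminus ` soc) (\<rho> k *\<^sub>R \<Phi> (S m (\<rho> k)) + m))"
    \<comment> \<open>The index shifts: \<open>x (Suc j)\<close> is computed from
      \<open>\<mu> j\<close>, while \<open>x 0\<close> is the prescribed start.\<close>
    define x where "x k = (case k of 0 \<Rightarrow> x0 | Suc j \<Rightarrow> S (\<mu> j) (\<rho> j))" for k
    have init: "x 0 = x0" "\<mu> 0 = \<mu>0" by (simp_all add: x_def \<mu>_def)
    have x_Suc: "x (Suc k) = S (\<mu> k) (\<rho> k)" for k by (simp add: x_def)
    have \<mu>_Suc: "\<mu> (Suc k) = closest_point (uminus ` soc) (\<rho> k *\<^sub>R \<Phi> (x (Suc k)) + \<mu> k)" for k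
      by (simp add: \<mu>_def x_Suc)
    define e where "e k = norm (x k - xb) + norm (\<mu> k - \<mu>b)" for k
    have step: "x (Suc k) \<in> ball xb r"
        "GDERIV (\<lambda>x. aug_lagrangian f \<Phi> x (\<mu> k) (\<rho> k)) (x (Suc k)) :> 0"
        "e (Suc k) \<le> norm (\<mu> k - \<mu>b) / 2"
      if "norm (\<mu> k - \<mu>b) \<le> \<gamma>" for k
      using S[OF that \<rho>[of k]] unfolding e_def \<mu>_Suc x_Suc by auto
    have \<mu>_near: "norm (\<mu> k - \<mu>b) \<le> \<gamma>" for k
    proof (induction k)
      case 0
      show ?case using \<mu>0 by (simp add: init)
    next
      case (Suc k)
      then have "e (Suc k) \<le> \<gamma> / 2" using step(3)[of k] by simp
      then show ?case unfolding e_def using norm_ge_zero[of "x (Suc k) - xb"] \<gamma> by linarith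
    qed
    have x_in: "x k \<in> ball xb r" for k
      using x0 init step(1)[OF \<mu>_near] by (cases k) (auto simp: dist_norm norm_minus_commute)
    have contract: "e (Suc k) \<le> 1 / 2 * e k" for k
      using step(3)[OF \<mu>_near[of k]] by (simp add: e_def add_increasing)
    have "ALM_sequence f \<Phi> \<rho> \<omega> x \<mu>"
      unfolding ALM_sequence_def
    proof (intro allI conjI)
      fix k
      show "(\<lambda>x'. lagrangian f \<Phi> x' (\<mu> k)) differentiable at (x k)"
        by (rule GDERIV_imp_differentiable[OF GDERIV_lagrangian_G[OF x_in]])
      show "(\<lambda>x'. aug_lagrangian f \<Phi> x' (\<mu> k) (\<rho> k)) differentiable at (x (Suc k))"
        by (rule GDERIV_imp_differentiable[OF step(2)[OF \<mu>_near]])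
      have "grad (\<lambda>x'. aug_lagrangian f \<Phi> x' (\<mu> k) (\<rho> k)) (x (Suc k)) = 0"
        by (rule grad_eqI[OF step(2)[OF \<mu>_near]])
      moreover have "0 \<le> \<omega> (residual f \<Phi> (x k) (\<mu> k))"
        using \<omega> by (simp add: tolerance_rule_def residual_def)
      ultimately show "norm (grad (\<lambda>x'. aug_lagrangian f \<Phi> x' (\<mu> k) (\<rho> k)) (x (Suc k)))
          \<le> \<omega> (residual f \<Phi> (x k) (\<mu> k))" by simp
      show "\<mu> (Suc k) = closest_point (uminus ` soc) (\<rho> k *\<^sub>R \<Phi> (x (Suc k)) + \<mu> k)"
        by (rule \<mu>_Suc)
    qed
    moreover have "linear_rate x \<mu> xb \<mu>b"
      unfolding linear_rate_def using contract
      by (intro exI[of _ "1 / 2"]) (auto simp: e_def)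
    moreover have "(\<lambda>k. (x k, \<mu> k)) \<longlonglongrightarrow> (xb, \<mu>b)"
    proof -
      have geo: "e k \<le> (1 / 2) ^ k * e 0" for k
      proof (induction k)
        case (Suc k)
        then show ?case using contract[of k] by simp
      qed simp
      have geo_lim: "(\<lambda>k. (1 / 2) ^ k * e 0) \<longlonglongrightarrow> 0"
        by (intro tendsto_mult_left_zero LIMSEQ_power_zero) simp
      have le: "norm (x k - xb) \<le> e k" "norm (\<mu> k - \<mu>b) \<le> e k" for k
        by (simp_all add: e_def)
      have "x \<longlonglongrightarrow> xb"
        by (rule LIM_zero_cancel, rule Lim_null_comparison[OF _ geo_lim])
          (intro always_eventually allI order_trans[OF le(1) geo])
      moreover have "\<mu> \<longlonglongrightarrow> \<mu>b"
        by (rule LIM_zero_cancel, rule Lim_null_comparison[OF _ geo_lim])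
          (intro always_eventually allI order_trans[OF le(2) geo])
      ultimately show ?thesis by (rule tendsto_Pair)
    qed
    ultimately show ?thesis using init by blast
  qed
  have "0 < min \<gamma> (r / 2)" using \<gamma> r by simp
  then show ?thesis using \<rho>b main by (intro exI[of _ "min \<gamma> (r / 2)"] exI[of _ \<rho>b] conjI) auto
qed

end

theorem theorem5p3:
  fixes f :: "real^'n \<Rightarrow> real"
    and \<Phi> :: "real^'n \<Rightarrow> real \<times> (real^'m)"
    and xb :: "real^'n"
    and \<mu>b :: "real \<times> (real^'m)"
  assumes "C2_around f xb"
    and "C2_around \<Phi> xb"
    and "KKT f \<Phi> xb \<mu>b"
    and "SOSC f \<Phi> xb \<mu>b"
    and "calm_at (multiplier_map f \<Phi> xb) (0, 0) \<mu>b"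
    and "multipliers f \<Phi> xb = {\<mu>b}"
  shows "\<exists>\<gamma>b>0. \<exists>\<rho>b>0.
    \<forall>(x0, \<mu>0) \<in> cball (xb, \<mu>b) \<gamma>b.
    \<forall>\<rho> :: nat \<Rightarrow> real. (\<forall>k. \<rho> k \<ge> \<rho>b) \<longrightarrow>
    (\<forall>\<omega>. tolerance_rule \<omega> \<longrightarrow>
      (\<exists>x \<mu>. x 0 = x0 \<and> \<mu> 0 = \<mu>0 \<and> ALM_sequence f \<Phi> \<rho> \<omega> x \<mu> \<and>
        (\<lambda>k. (x k, \<mu> k)) \<longlonglongrightarrow> (xb, \<mu>b) \<and> linear_rate x \<mu> xb \<mu>b))"
proof -
  obtain U Df Df2 where U: "open U" "xb \<in> U" "\<And>x. x \<in> U \<Longrightarrow> (f has_derivative blinfun_apply (Df x)) (at x)"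
    "\<And>x. x \<in> U \<Longrightarrow> (Df has_derivative blinfun_apply (Df2 x)) (at x)"
    using assms(1) unfolding C2_around_def by blast
  obtain V D D2 where V: "open V" "xb \<in> V" "\<And>x. x \<in> V \<Longrightarrow> (\<Phi> has_derivative blinfun_apply (D x)) (at x)"
    "\<And>x. x \<in> V \<Longrightarrow> (D has_derivative blinfun_apply (D2 x)) (at x)"
    using assms(2) unfolding C2_around_def by blast
  obtain r where r: "0 < r" "ball xb r \<subseteq> U \<inter> V"
    using open_contains_ball[of "U \<inter> V"] U(1,2) V(1,2) by (meson IntI open_Int)
  interpret soc_program f \<Phi> xb \<mu>b r Df D "blinfun_apply (Df2 xb)" "blinfun_apply (D2 xb)"
    using U V r assms(4-6) by unfold_locales auto
  show ?thesis by (rule alm_convergence)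
qed

end
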